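(* Let $n_1,n_2,\ldots$ be a lacunary sequence of positive integers. Then for every sufficiently large $A>2$ (that is, there is $A_0\ge 2$ such that for every $A > A_0$) the following holds. Let $\nu$ be a Borel probability measure supported on $[0,1]^2$ such that $\widehat{\nu}(\boldsymbol{\xi}) \ll (\log\|\boldsymbol{\xi}\|_\infty)^{-A}$ as $\|\boldsymbol{\xi}\|_\infty\to\infty$, $\boldsymbol{\xi}\in\mathbb{Z}^2$. Let $\psi:\mathbb{N}\to[0,1]$, and write $\mathcal{W}(\psi)$ for the set of $(\beta,\delta)\in[0,1]^2$ such that $$\|n_t\beta-\delta\|\le\psi(t)$$ has infinitely many solutions $t\in\mathbb{N}$. Then $$\nu(\mathcal{W}(\psi)) = \begin{cases} 0, & \text{if } \sum_{t=1}^\infty\psi(t)<\infty,\\ 1, & \text{if } \sum_{t=1}^\infty\psi(t)=\infty.\end{cases}$$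
   Context: For $x\in\mathbb{R}$, $\|x\|$ denotes the distance from $x$ to the nearest integer. A sequence $(n_t)$ of positive integers is lacunary if there is $c>1$ with $n_{t+1}\ge c\, n_t$ for all $t\ge1$. The Fourier transform is $\widehat{\nu}(\boldsymbol{\xi}) = \int e(-\boldsymbol{\xi}\cdot\mathbf{x})\,d\nu(\mathbf{x})$ with $e(x)=e^{2\pi i x}$, and $\|\boldsymbol{\xi}\|_\infty=\max(|\xi_1|,|\xi_2|)$. The notation $f\ll g$ means $|f|\le C|g|$ for some constant $C>0$. *)

theory Defs
  imports "HOL-Probability.Probability"
begin

text \<open>
  Sequences indexed by the positive integers are functions on \<^typ>\<open>nat\<close> of which only the values
  at \<open>t \<ge> 1\<close> are used.  Points of the plane are elements of \<^typ>\<open>real \<times> real\<close>, whose library norm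
  is the Euclidean one; the maximum norm is therefore defined separately.
\<close>

definition dist_int :: "real \<Rightarrow> real" where
  "dist_int x = dist x (of_int (round x))"

definition lacunary :: "(nat \<Rightarrow> nat) \<Rightarrow> bool" where
  "lacunary n \<longleftrightarrow> (\<exists>c>1. \<forall>t\<ge>1. real (n (t + 1)) \<ge> c * real (n t))"

definition unit_exp :: "real \<Rightarrow> complex" where
  "unit_exp x = exp (2 * of_real pi * \<i> * of_real x)"

definition fourier :: "(real \<times> real) measure \<Rightarrow> real \<times> real \<Rightarrow> complex" where
  "fourier \<nu> \<xi> = (LINT x|\<nu>. unit_exp (- (\<xi> \<bullet> x)))"

definition max_norm :: "real \<times> real \<Rightarrow> real" where
  "max_norm \<xi> = max \<bar>fst \<xi>\<bar> \<bar>snd \<xi>\<bar>"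

text \<open>
  The bound is required at integer frequencies of large maximum norm only; in particular the values
  of \<^const>\<open>ln\<close> and \<^const>\<open>powr\<close> outside their natural domains play no role.
\<close>

definition log_decay :: "(real \<times> real) measure \<Rightarrow> real \<Rightarrow> bool" where
  "log_decay \<nu> A \<longleftrightarrow>
     (\<exists>C>0. \<exists>R. \<forall>\<xi> \<in> \<int> \<times> \<int>. max_norm \<xi> \<ge> R \<longrightarrow>
        norm (fourier \<nu> \<xi>) \<le> C * ln (max_norm \<xi>) powr (- A))"

definition W_set :: "(nat \<Rightarrow> nat) \<Rightarrow> (nat \<Rightarrow> real) \<Rightarrow> (real \<times> real) set" where
  "W_set n \<psi> = {(\<beta>, \<delta>) \<in> {0..1} \<times> {0..1}.
     infinite {t. t \<ge> 1 \<and> dist_int (real (n t) * \<beta> - \<delta>) \<le> \<psi> t}}"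

text \<open>
  The library's measures give the value 0 to non-measurable sets; the next fact shows that this
  convention does not affect the measure of \<open>W_set n \<psi>\<close>.
\<close>

lemma W_set_borel: "W_set n \<psi> \<in> sets borel"
proof -
  have [measurable]: "dist_int \<in> borel_measurable borel"
    unfolding dist_int_def dist_real_def round_def by measurable
  have "W_set n \<psi> = {p \<in> space borel. fst p \<in> {0..1} \<and> snd p \<in> {0..1} \<and>
     (\<forall>m. \<exists>t>m. t \<ge> 1 \<and> dist_int (real (n t) * fst p - snd p) \<le> \<psi> t)}"
    by (auto simp: W_set_def infinite_nat_iff_unbounded)
  also have "\<dots> \<in> sets (borel \<Otimes>\<^sub>M borel)"
    unfolding borel_prod[symmetric] by measurable
  finally show ?thesis by (simp only: borel_prod)
qed

end

theory Submission
  imports Defs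
begin

text \<open>
  The exponent \<open>A0 = 2\<close> suffices.  The idea is to test \<open>\<nu>\<close> against 1-periodic functions of
  \<open>n t * \<beta> - \<delta>\<close> that are built from Poisson kernels
  \<open>P\<^sub>r x = (\<Sum>k. r ^ \<bar>k\<bar> * e(k x))\<close>.  With \<open>\<epsilon> = \<psi> t / 2\<close> and \<open>r = 1 - \<epsilon>\<close>, a multiple of
  \<open>\<epsilon> P\<^sub>r\<close> majorises the indicator of \<open>\<parallel>x\<parallel> \<le> \<psi> t\<close>, while
  \<open>\<epsilon> / 2 * (P\<^sub>r - 3 / 4 * P\<^sub>s)\<close> with \<open>s = r\<^sup>2\<close> is a minorant: at the origin the narrower
  kernel dominates, whereas the tail of \<open>P\<^sub>s\<close> is about twice as heavy as that of \<open>P\<^sub>r\<close>, so that the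
  factor \<open>3 / 4\<close> lies above the threshold \<open>1 / 2\<close> at which the tail becomes negative and below
  the threshold 1 at which the mean value vanishes.  Both functions have mean value comparable to
  \<open>\<psi> t\<close> and nonnegative Fourier coefficients of bounded total mass, given by geometric
  progressions.

  \<^item> Expanding the majorant, the terms with \<open>k \<noteq> 0\<close> involve the Fourier transform at
    \<open>(- k n t, k)\<close>, whose norm is exponentially large in \<open>t\<close>; hence the strip
    \<open>\<parallel>n t * \<beta> - \<delta>\<parallel> \<le> \<psi> t\<close> has measure \<open>O(\<psi> t + t powr - A)\<close>, and if \<open>\<psi>\<close> is summable
    the Borel--Cantelli lemma applies (\<open>AE_finitely_many_hits\<close>).

  \<^item> If \<open>\<psi>\<close> is not summable, the minorants \<open>h t\<close> are shown to be nearly uncorrelated.  The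
    correlation of \<open>h s\<close> and \<open>h t\<close> for \<open>s < t\<close> involves the frequencies
    \<open>(- (k n s + l n t), k + l)\<close>.  Most of them are exponentially large in \<open>t\<close> and contribute
    \<open>O(t powr - A)\<close>; those with \<open>l = 0\<close> contribute \<open>O(\<psi> t * s powr - A)\<close>.  There may remain
    genuinely small frequencies, because \<open>k n s\<close> can nearly cancel \<open>l n t\<close>; but then \<open>k\<close> is
    determined by \<open>l\<close> and is at least of order \<open>\<bar>l\<bar> * n t / n s\<close>, and the decay of the
    coefficients of \<open>h s\<close> bounds their contribution by \<open>O(\<psi> t * n s / n t)\<close>
    (\<open>minorant_correlation\<close>).  The sum of all these errors is
    \<open>O(1 + \<Sum>t\<le>T. \<psi> t)\<close>, where \<open>A > 2\<close> is what makes \<open>\<Sum>t. t * t powr - A\<close> converge.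
    So the variance of \<open>\<Sum>t\<le>T. h t\<close> is at most of the order of its mean, and Chebyshev's inequality
    makes the number of hits infinite almost everywhere (\<open>AE_infinitely_many_hits\<close>).
\<close>

section \<open>Poisson kernels as majorants and minorants\<close>

lemma unit_exp_add: "unit_exp (x + y) = unit_exp x * unit_exp y"
  by (simp add: unit_exp_def ring_distribs exp_add)

lemma norm_unit_exp [simp]: "norm (unit_exp x) = 1"
  using norm_exp_i_times[of "2 * pi * x"] by (simp add: unit_exp_def algebra_simps)

lemma unit_exp_0 [simp]: "unit_exp 0 = 1"
  by (simp add: unit_exp_def)

lemma unit_exp_of_nat_mult: "unit_exp (real n * x) = unit_exp x ^ n"
  unfolding unit_exp_def exp_of_nat_mult[symmetric] by (simp add: algebra_simps)

lemma unit_exp_minus: "unit_exp (- x) = cnj (unit_exp x)"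
  by (simp add: unit_exp_def exp_cnj)

lemma Re_unit_exp: "Re (unit_exp x) = cos (2 * pi * x)"
  by (simp add: unit_exp_def Re_exp)

lemma unit_exp_measurable [measurable]: "unit_exp \<in> borel_measurable borel"
  unfolding unit_exp_def by (intro borel_measurable_continuous_onI continuous_intros)

definition trig_sum :: "(int \<Rightarrow> real) \<Rightarrow> nat \<Rightarrow> real \<Rightarrow> complex" where
  "trig_sum a K x = (\<Sum>k = - int K..int K. of_real (a k) * unit_exp (of_int k * x))"

text \<open>
  The bound on the coefficient sums gives absolute convergence, hence uniform bounds on the partial
  sums.  The number 2 is what the majorant below satisfies for every width.
\<close>
definition positive_fourier_series :: "(real \<Rightarrow> real) \<Rightarrow> (int \<Rightarrow> real) \<Rightarrow> bool" where
  "positive_fourier_series g a \<longleftrightarrow>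
     (\<forall>k. 0 \<le> a k) \<and> (\<forall>K. (\<Sum>k = - int K..int K. a k) \<le> 2) \<and>
     (\<forall>x. (\<lambda>K. trig_sum a K x) \<longlonglongrightarrow> of_real (g x))"

definition poisson_kernel :: "real \<Rightarrow> real \<Rightarrow> real" where
  "poisson_kernel r x = (1 - r\<^sup>2) / ((1 - r)\<^sup>2 + 2 * r * (1 - cos (2 * pi * x)))"

lemma sum_symmetric_int_interval:
  fixes f :: "int \<Rightarrow> 'a :: comm_monoid_add"
  shows "(\<Sum>k = - int K..int K. f k) = f 0 + (\<Sum>k<K. f (int (Suc k)) + f (- int (Suc k)))"
proof (induction K)
  case (Suc K)
  have "{- int (Suc K)..int (Suc K)} = insert (int (Suc K)) (insert (- int (Suc K)) {- int K..int K})"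
    by auto
  then show ?case using Suc by (simp add: add_ac)
qed simp

text \<open>
  The positive and the negative frequencies form two complex conjugate geometric series.
\<close>
lemma poisson_kernel_trig_sum:
  assumes "0 \<le> r" "r < 1"
  shows "(\<lambda>K. trig_sum (\<lambda>k. r ^ nat \<bar>k\<bar>) K x) \<longlonglongrightarrow> of_real (poisson_kernel r x)"
proof -
  define z where "z = of_real r * unit_exp x"
  have nz: "norm z = r" "norm (cnj z) = r" using assms by (auto simp: z_def norm_mult)
  have trig: "trig_sum (\<lambda>k. r ^ nat \<bar>k\<bar>) K x = 1 + ((\<Sum>k<K. z ^ Suc k) + (\<Sum>k<K. cnj z ^ Suc k))" for K
  proof -
    have "of_real (r ^ nat \<bar>int (Suc k)\<bar>) * unit_exp (of_int (int (Suc k)) * x)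
          + of_real (r ^ nat \<bar>- int (Suc k)\<bar>) * unit_exp (of_int (- int (Suc k)) * x)
        = z ^ Suc k + cnj z ^ Suc k" for k
    proof -
      have "unit_exp (of_int (int (Suc k)) * x) = unit_exp x ^ Suc k"
        using unit_exp_of_nat_mult[of "Suc k" x] by simp
      moreover have "unit_exp (of_int (- int (Suc k)) * x) = cnj (unit_exp x) ^ Suc k"
        using unit_exp_of_nat_mult[of "Suc k" "- x"] by (simp add: unit_exp_minus algebra_simps)
      moreover have "nat \<bar>int (Suc k)\<bar> = Suc k" "nat \<bar>- int (Suc k)\<bar> = Suc k" by auto
      ultimately show ?thesis
        by (simp only: z_def power_mult_distrib complex_cnj_mult complex_cnj_complex_of_real of_real_power)
    qed
    then show ?thesis
      unfolding trig_sum_def sum_symmetric_int_interval sum.distrib[symmetric] by simp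
  qed
  have g: "(\<lambda>K. \<Sum>k<K. w ^ Suc k) \<longlonglongrightarrow> w * (1 / (1 - w))" if "norm w = r" for w :: complex
  proof -
    have "(\<lambda>k. w * w ^ k) sums (w * (1 / (1 - w)))"
      by (intro sums_mult geometric_sums) (use that assms in auto)
    then show ?thesis by (simp add: sums_def)
  qed
  have "(\<lambda>K. 1 + ((\<Sum>k<K. z ^ Suc k) + (\<Sum>k<K. cnj z ^ Suc k)))
        \<longlonglongrightarrow> 1 + (z * (1 / (1 - z)) + cnj z * (1 / (1 - cnj z)))"
    by (intro tendsto_intros g nz)
  moreover have "1 + (z * (1 / (1 - z)) + cnj z * (1 / (1 - cnj z))) = of_real (poisson_kernel r x)"
  proof -
    have z1: "1 - z \<noteq> 0" "1 - cnj z \<noteq> 0" using nz assms by auto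
    have zz: "z * cnj z = of_real (r\<^sup>2)"
      using nz by (simp add: complex_norm_square[symmetric])
    have zs: "z + cnj z = of_real (2 * r * cos (2 * pi * x))"
      unfolding complex_add_cnj by (simp add: z_def Re_unit_exp)
    have "(1 - z) * (1 - cnj z) = of_real ((1 - r)\<^sup>2 + 2 * r * (1 - cos (2 * pi * x)))"
    proof -
      have "(1 - z) * (1 - cnj z) = 1 - (z + cnj z) + z * cnj z" by (simp add: algebra_simps)
      then show ?thesis unfolding zz zs by (simp add: algebra_simps power2_eq_square)
    qed
    moreover have "1 + (z * (1 / (1 - z)) + cnj z * (1 / (1 - cnj z))) =
        (1 - z * cnj z) / ((1 - z) * (1 - cnj z))"
      using z1 by (simp add: divide_simps) (simp add: algebra_simps)
    ultimately show ?thesis unfolding zz poisson_kernel_def by simp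
  qed
  ultimately show ?thesis unfolding trig by simp
qed

text \<open>
  The parameter \<open>\<epsilon>\<close> is half the radius of the neighbourhood of the integers whose indicator
  is approximated.  The squared radius \<open>(1 - \<epsilon>)\<^sup>2\<close> in the minorant doubles the width of the kernel
  and keeps all formulas rational.  For \<open>\<epsilon> = 0\<close> both functions vanish.
\<close>
definition majorant :: "real \<Rightarrow> real \<Rightarrow> real" where
  "majorant \<epsilon> x = \<epsilon> * poisson_kernel (1 - \<epsilon>) x"

definition minorant :: "real \<Rightarrow> real \<Rightarrow> real" where
  "minorant \<epsilon> x = \<epsilon> / 2 * (poisson_kernel (1 - \<epsilon>) x - 3 / 4 * poisson_kernel ((1 - \<epsilon>)\<^sup>2) x)"

definition majorant_coeff :: "real \<Rightarrow> int \<Rightarrow> real" where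
  "majorant_coeff \<epsilon> k = \<epsilon> * (1 - \<epsilon>) ^ nat \<bar>k\<bar>"

definition minorant_coeff :: "real \<Rightarrow> int \<Rightarrow> real" where
  "minorant_coeff \<epsilon> k = \<epsilon> / 2 * ((1 - \<epsilon>) ^ nat \<bar>k\<bar> - 3 / 4 * ((1 - \<epsilon>)\<^sup>2) ^ nat \<bar>k\<bar>)"

text \<open>
  The factor \<open>\<epsilon>\<close> cancels the value \<open>1 / \<epsilon>\<close> of the geometric series, so the bound is uniform
  in the width.
\<close>
lemma majorant_coeff_sum_le:
  assumes "0 \<le> \<epsilon>" "\<epsilon> \<le> 1"
  shows "(\<Sum>k = - int K..int K. majorant_coeff \<epsilon> k) \<le> 2"
proof -
  have "(\<Sum>k = - int K..int K. majorant_coeff \<epsilon> k) = \<epsilon> + 2 * (1 - \<epsilon>) * (\<epsilon> * (\<Sum>k<K. (1 - \<epsilon>) ^ k))"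
    by (simp add: sum_symmetric_int_interval majorant_coeff_def sum_distrib_left algebra_simps nat_add_distrib)
  also have "\<epsilon> * (\<Sum>k<K. (1 - \<epsilon>) ^ k) = 1 - (1 - \<epsilon>) ^ K"
    using one_diff_power_eq[of "1 - \<epsilon>" K] by simp
  also have "\<epsilon> + 2 * (1 - \<epsilon>) * (1 - (1 - \<epsilon>) ^ K) \<le> \<epsilon> + 2 * (1 - \<epsilon>) * 1"
    using assms by (intro add_left_mono mult_left_mono) auto
  also have "\<dots> \<le> 2" using assms by simp
  finally show ?thesis .
qed

lemma minorant_coeff_bounds:
  assumes "0 \<le> \<epsilon>" "\<epsilon> \<le> 1"
  shows "0 \<le> minorant_coeff \<epsilon> k" "minorant_coeff \<epsilon> k \<le> majorant_coeff \<epsilon> k / 2"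
proof -
  let ?p = "(1 - \<epsilon>) ^ nat \<bar>k\<bar>"
  have p: "0 \<le> ?p" "?p \<le> 1" using assms by (auto intro: power_le_one)
  have "((1 - \<epsilon>)\<^sup>2) ^ nat \<bar>k\<bar> = ?p * ?p"
    by (simp add: power_mult_distrib power2_eq_square)
  moreover have "0 \<le> ?p * ?p" "?p * ?p \<le> ?p" using p by (auto intro: mult_left_le)
  ultimately have b: "0 \<le> ?p - 3 / 4 * ((1 - \<epsilon>)\<^sup>2) ^ nat \<bar>k\<bar>" "?p - 3 / 4 * ((1 - \<epsilon>)\<^sup>2) ^ nat \<bar>k\<bar> \<le> ?p"
    by linarith+
  show "0 \<le> minorant_coeff \<epsilon> k"
    unfolding minorant_coeff_def using assms by (intro mult_nonneg_nonneg b(1)) simp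
  show "minorant_coeff \<epsilon> k \<le> majorant_coeff \<epsilon> k / 2"
    unfolding minorant_coeff_def majorant_coeff_def
    using mult_left_mono[OF b(2), of "\<epsilon> / 2"] assms by simp
qed

lemma positive_fourier_series_majorant:
  assumes "0 < \<epsilon>" "\<epsilon> \<le> 1"
  shows "positive_fourier_series (majorant \<epsilon>) (majorant_coeff \<epsilon>)"
proof -
  have "(\<lambda>K. of_real \<epsilon> * trig_sum (\<lambda>k. (1 - \<epsilon>) ^ nat \<bar>k\<bar>) K x)
      \<longlonglongrightarrow> of_real \<epsilon> * of_real (poisson_kernel (1 - \<epsilon>) x)" for x
    using assms by (intro tendsto_intros poisson_kernel_trig_sum) auto
  then show ?thesis
    using assms majorant_coeff_sum_le[of \<epsilon>]
    by (simp add: positive_fourier_series_def majorant_def majorant_coeff_def trig_sum_def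
        sum_distrib_left mult_ac)
qed

lemma positive_fourier_series_minorant:
  assumes "0 \<le> \<epsilon>" "\<epsilon> \<le> 1"
  shows "positive_fourier_series (minorant \<epsilon>) (minorant_coeff \<epsilon>)"
proof (cases "\<epsilon> = 0")
  case True
  then show ?thesis
    by (simp add: positive_fourier_series_def minorant_def minorant_coeff_def trig_sum_def)
next
  case False
  then have r: "0 \<le> 1 - \<epsilon>" "1 - \<epsilon> < 1" "0 \<le> (1 - \<epsilon>)\<^sup>2" "(1 - \<epsilon>)\<^sup>2 < 1"
    using assms power_strict_mono[of "1 - \<epsilon>" 1 2] by auto
  have "(\<lambda>K. of_real (\<epsilon> / 2) * (trig_sum (\<lambda>k. (1 - \<epsilon>) ^ nat \<bar>k\<bar>) K x
          - of_real (3 / 4) * trig_sum (\<lambda>k. ((1 - \<epsilon>)\<^sup>2) ^ nat \<bar>k\<bar>) K x))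
      \<longlonglongrightarrow> of_real (\<epsilon> / 2) * (of_real (poisson_kernel (1 - \<epsilon>) x)
          - of_real (3 / 4) * of_real (poisson_kernel ((1 - \<epsilon>)\<^sup>2) x))" for x
    using r by (intro tendsto_intros poisson_kernel_trig_sum) auto
  moreover have "of_real (\<epsilon> / 2) * (trig_sum (\<lambda>k. (1 - \<epsilon>) ^ nat \<bar>k\<bar>) K x
          - of_real (3 / 4) * trig_sum (\<lambda>k. ((1 - \<epsilon>)\<^sup>2) ^ nat \<bar>k\<bar>) K x)
      = trig_sum (minorant_coeff \<epsilon>) K x" for K x
    unfolding trig_sum_def sum_distrib_left sum_subtractf[symmetric]
    by (intro sum.cong refl) (simp add: minorant_coeff_def algebra_simps)
  ultimately have "(\<lambda>K. trig_sum (minorant_coeff \<epsilon>) K x) \<longlonglongrightarrow> of_real (minorant \<epsilon> x)" for x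
    by (simp add: minorant_def)
  moreover have "(\<Sum>k = - int K..int K. minorant_coeff \<epsilon> k) \<le> 2" for K
  proof -
    have "(\<Sum>k = - int K..int K. minorant_coeff \<epsilon> k) \<le> (\<Sum>k = - int K..int K. majorant_coeff \<epsilon> k / 2)"
      using assms by (intro sum_mono minorant_coeff_bounds) auto
    also have "\<dots> \<le> 2" using majorant_coeff_sum_le[OF assms, of K]
      by (simp add: sum_divide_distrib[symmetric])
    finally show ?thesis .
  qed
  ultimately show ?thesis
    using minorant_coeff_bounds(1)[OF assms] by (simp add: positive_fourier_series_def)
qed

lemma cos_2pi_dist_int: "cos (2 * pi * x) = cos (2 * pi * dist_int x)"
proof -
  have "cos (2 * pi * (x - of_int (round x))) = cos (2 * pi * x)"
    using cos_int_2pin[of "round x"] sin_int_2pin[of "round x"]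
    by (simp add: right_diff_distrib cos_diff)
  moreover have "cos (2 * pi * \<bar>x - of_int (round x)\<bar>) = cos (2 * pi * (x - of_int (round x)))"
    by (simp add: abs_if right_diff_distrib[symmetric]) (metis cos_minus minus_diff_eq mult_minus_right)
  ultimately show ?thesis by (simp add: dist_int_def dist_real_def)
qed

lemma one_minus_cos: "1 - cos (2 * pi * x) = 2 * (sin (pi * x))\<^sup>2"
  using cos_double_sin[of "pi * x"] by (simp add: mult_ac)

lemma one_minus_cos_le: "1 - cos (2 * pi * x) \<le> 20 * (dist_int x)\<^sup>2"
proof -
  have "(sin (pi * dist_int x))\<^sup>2 \<le> (pi * dist_int x)\<^sup>2"
    using abs_sin_x_le_abs_x[of "pi * dist_int x"] by (simp only: abs_le_square_iff)
  also have "\<dots> \<le> 10 * (dist_int x)\<^sup>2"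
  proof -
    have "pi\<^sup>2 \<le> 3.15\<^sup>2" using pi_approx by (intro power_mono) auto
    then have "pi\<^sup>2 \<le> 10" by (simp add: power2_eq_square)
    then show ?thesis by (simp add: power_mult_distrib mult_right_mono)
  qed
  finally show ?thesis unfolding cos_2pi_dist_int[of x] one_minus_cos by simp
qed

lemma dist_int_bounds: "0 \<le> dist_int x" "dist_int x \<le> 1 / 2"
  using of_int_round_abs_le[of x] by (auto simp: dist_int_def dist_real_def abs_minus_commute)

lemma one_minus_cos_ge: "8 * (dist_int x)\<^sup>2 \<le> 1 - cos (2 * pi * x)"
proof -
  let ?y = "dist_int x"
  have "2 * ?y \<le> sin (pi * ?y)"
  proof -
    have "concave_on {0..pi / 2} sin"
    proof (rule f''_le0_imp_concave)
      show "(sin has_real_derivative cos y) (at y)" "(cos has_real_derivative - sin y) (at y)" for y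
        by (auto intro!: derivative_eq_intros)
      show "- sin y \<le> 0" if "y \<in> {0..pi / 2}" for y
        using that pi_gt_zero by (auto intro!: sin_ge_zero)
    qed simp
    from concave_onD[OF this, of "2 * ?y" 0 "pi / 2"] show ?thesis
      using dist_int_bounds[of x] pi_gt_zero by (simp add: mult_ac)
  qed
  then have "(2 * ?y)\<^sup>2 \<le> (sin (pi * ?y))\<^sup>2"
    using dist_int_bounds by (intro power_mono) auto
  then show ?thesis unfolding cos_2pi_dist_int[of x] one_minus_cos by (simp add: power2_eq_square)
qed

lemma poisson_kernel_nonneg:
  assumes "0 \<le> r" "r \<le> 1"
  shows "0 \<le> poisson_kernel r x"
  using assms unfolding poisson_kernel_def
  by (intro divide_nonneg_nonneg add_nonneg_nonneg mult_nonneg_nonneg) (auto simp: power_le_one)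

text \<open>
  The constant 161 is \<open>1 + 2 * 20 * 2\<^sup>2\<close>: on the strip, \<open>1 - cos (2 * pi * x)\<close> is at most
  \<open>20 * (2 * \<epsilon>)\<^sup>2\<close>, so the denominator of the kernel is at most 161 times its minimum \<open>\<epsilon>\<^sup>2\<close>.
\<close>
lemma majorant_ge_on_strip:
  assumes "0 < \<epsilon>" "\<epsilon> \<le> 1" "dist_int x \<le> 2 * \<epsilon>"
  shows "1 \<le> 161 * majorant \<epsilon> x"
proof -
  let ?D = "\<epsilon>\<^sup>2 + 2 * (1 - \<epsilon>) * (1 - cos (2 * pi * x))"
  have "1 - cos (2 * pi * x) \<le> 20 * (2 * \<epsilon>)\<^sup>2"
    using one_minus_cos_le[of x] assms dist_int_bounds[of x] power_mono[of "dist_int x" "2 * \<epsilon>" 2]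
    by simp
  moreover define W where "W = (1 - \<epsilon>) * (1 - cos (2 * pi * x))"
  ultimately have "W \<le> 1 * (20 * (2 * \<epsilon>)\<^sup>2)"
    unfolding W_def using assms by (intro mult_mono) auto
  moreover have "?D = \<epsilon>\<^sup>2 + 2 * W" by (simp only: W_def mult.assoc)
  ultimately have "?D \<le> 161 * \<epsilon>\<^sup>2" by (simp add: power_mult_distrib)
  moreover have "?D > 0"
    using assms by (intro add_pos_nonneg mult_nonneg_nonneg) auto
  ultimately have "\<epsilon> * \<epsilon> * (2 - \<epsilon>) / ?D \<ge> \<epsilon> * \<epsilon> * 1 / (161 * \<epsilon>\<^sup>2)"
    using assms by (intro frac_le mult_left_mono mult_nonneg_nonneg) auto
  moreover have "majorant \<epsilon> x = \<epsilon> * \<epsilon> * (2 - \<epsilon>) / ?D"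
    by (simp add: majorant_def poisson_kernel_def power2_eq_square algebra_simps)
  ultimately show ?thesis using assms by (simp add: power2_eq_square mult_ac)
qed

text \<open>
  After clearing denominators, both claims compare the two denominators as functions of
  \<open>u = 1 - cos (2 * pi * x)\<close>, in which they are affine.  The second claim says that the wider
  kernel wins once \<open>x\<close> is further from the integers than a fixed multiple of the width.
\<close>
lemma poisson_kernel_square_compare:
  assumes "1 / 2 \<le> r" "r < 1"
  shows "poisson_kernel (r\<^sup>2) x \<le> 4 * poisson_kernel r x"
    and "4 * (1 - r)\<^sup>2 \<le> (1 - cos (2 * pi * x)) * r\<^sup>2 \<Longrightarrow> poisson_kernel r x \<le> 3 / 4 * poisson_kernel (r\<^sup>2) x"
proof -
  define u where "u = 1 - cos (2 * pi * x)"
  define D where "D = (1 - r)\<^sup>2 + 2 * r * u"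
  define E where "E = (1 - r\<^sup>2)\<^sup>2 + 2 * r\<^sup>2 * u"
  have u: "u \<ge> 0" by (simp add: u_def)
  have r2: "r\<^sup>2 < 1" using assms power_strict_mono[of r 1 2] by simp
  have D: "D > 0" unfolding D_def using assms u by (intro add_pos_nonneg) auto
  have E: "E > 0" unfolding E_def using assms u r2 by (intro add_pos_nonneg) auto
  have P: "poisson_kernel r x = (1 - r\<^sup>2) / D"
    by (simp add: poisson_kernel_def D_def u_def)
  have Q: "poisson_kernel (r\<^sup>2) x = (1 - r\<^sup>2) * (1 + r\<^sup>2) / E"
    by (simp add: poisson_kernel_def E_def u_def algebra_simps power2_eq_square)
  have "(1 + r\<^sup>2) * D \<le> 4 * E"
  proof -
    have "(1 + r\<^sup>2) * (1 - r)\<^sup>2 \<le> 4 * (1 - r\<^sup>2)\<^sup>2"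
    proof -
      have "(1 - r\<^sup>2)\<^sup>2 = (1 + r)\<^sup>2 * (1 - r)\<^sup>2" by (simp add: power2_eq_square algebra_simps)
      moreover have "1 + r\<^sup>2 \<le> 4 * (1 + r)\<^sup>2" using assms r2 by (simp add: power2_eq_square algebra_simps)
      ultimately show ?thesis using mult_right_mono[of "1 + r\<^sup>2" "4 * (1 + r)\<^sup>2" "(1 - r)\<^sup>2"] by simp
    qed
    moreover have "(1 + r\<^sup>2) * (2 * r * u) \<le> 4 * (2 * r\<^sup>2 * u)"
    proof -
      have "1 + r\<^sup>2 \<le> 4 * r" using assms r2 by linarith
      then have "(1 + r\<^sup>2) * (2 * r * u) \<le> (4 * r) * (2 * r * u)"
        using assms u by (intro mult_right_mono) auto
      then show ?thesis by (simp add: power2_eq_square mult_ac)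
    qed
    ultimately show ?thesis by (simp add: D_def E_def ring_distribs)
  qed
  then have "(1 - r\<^sup>2) * ((1 + r\<^sup>2) * D) \<le> (1 - r\<^sup>2) * (4 * E)"
    using r2 by (intro mult_left_mono) auto
  then show "poisson_kernel (r\<^sup>2) x \<le> 4 * poisson_kernel r x"
    unfolding P Q using D E by (simp add: field_simps)
  assume *: "4 * (1 - r)\<^sup>2 \<le> (1 - cos (2 * pi * x)) * r\<^sup>2"
  have "4 * E \<le> 3 * ((1 + r\<^sup>2) * D)"
  proof -
    have "3 * ((1 + r\<^sup>2) * D) - 4 * E =
        u * r * (6 * (1 + r\<^sup>2) - 8 * r) - (1 - r)\<^sup>2 * (4 * (1 + r)\<^sup>2 - 3 * (1 + r\<^sup>2))"
      by (simp add: D_def E_def power2_eq_square algebra_simps)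
    moreover have "u * r * (4 * r) \<le> u * r * (6 * (1 + r\<^sup>2) - 8 * r)"
    proof (intro mult_left_mono mult_nonneg_nonneg u)
      have "0 \<le> 6 * (1 - r)\<^sup>2" by simp
      then show "4 * r \<le> 6 * (1 + r\<^sup>2) - 8 * r" by (simp add: power2_eq_square algebra_simps)
    qed (use assms in auto)
    moreover have "(1 - r)\<^sup>2 * (4 * (1 + r)\<^sup>2 - 3 * (1 + r\<^sup>2)) \<le> (1 - r)\<^sup>2 * 16"
    proof (intro mult_left_mono)
      show "4 * (1 + r)\<^sup>2 - 3 * (1 + r\<^sup>2) \<le> 16"
        using assms r2 by (simp add: power2_eq_square algebra_simps)
    qed simp
    ultimately show ?thesis using * by (simp add: u_def power2_eq_square algebra_simps)
  qed
  then have "(1 - r\<^sup>2) * (4 * E) \<le> (1 - r\<^sup>2) * (3 * ((1 + r\<^sup>2) * D))"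
    using r2 by (intro mult_left_mono) auto
  then show "poisson_kernel r x \<le> 3 / 4 * poisson_kernel (r\<^sup>2) x"
    unfolding P Q using D E by (simp add: field_simps)
qed

lemma minorant_abs_le:
  assumes "0 \<le> \<epsilon>" "\<epsilon> \<le> 1 / 2"
  shows "\<bar>minorant \<epsilon> x\<bar> \<le> 2 * majorant \<epsilon> x"
proof (cases "\<epsilon> = 0")
  case False
  let ?P = "poisson_kernel (1 - \<epsilon>) x" and ?Q = "poisson_kernel ((1 - \<epsilon>)\<^sup>2) x"
  have "0 \<le> ?P" "0 \<le> ?Q" "?Q \<le> 4 * ?P"
    using assms False poisson_kernel_square_compare(1)[of "1 - \<epsilon>" x]
    by (auto intro!: poisson_kernel_nonneg power_le_one)
  then have "\<bar>?P - 3 / 4 * ?Q\<bar> \<le> 4 * ?P" by linarith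
  then have "\<epsilon> / 2 * \<bar>?P - 3 / 4 * ?Q\<bar> \<le> \<epsilon> / 2 * (4 * ?P)"
    using assms by (intro mult_left_mono) auto
  then show ?thesis using assms by (simp add: minorant_def majorant_def abs_mult)
qed (simp add: minorant_def majorant_def)

text \<open>
  Near the integers only the peak value \<open>2 / \<epsilon>\<close> of the narrow kernel matters; elsewhere the
  wider kernel makes the combination nonpositive.
\<close>
lemma minorant_le_indicator:
  assumes "0 \<le> \<epsilon>" "\<epsilon> \<le> 1 / 2"
  shows "minorant \<epsilon> x \<le> (if dist_int x \<le> 2 * \<epsilon> then 1 else 0)"
proof (cases "\<epsilon> = 0")
  case False
  let ?P = "poisson_kernel (1 - \<epsilon>) x" and ?Q = "poisson_kernel ((1 - \<epsilon>)\<^sup>2) x"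
  have \<epsilon>: "0 < \<epsilon>" using False assms by simp
  have Q: "0 \<le> ?Q" using assms by (intro poisson_kernel_nonneg) (auto intro: power_le_one)
  have "minorant \<epsilon> x \<le> 1"
  proof -
    have "?P \<le> (1 - (1 - \<epsilon>)\<^sup>2) / \<epsilon>\<^sup>2"
      unfolding poisson_kernel_def using assms \<epsilon>
      by (intro divide_left_mono mult_pos_pos add_pos_nonneg) (auto simp: power_le_one)
    also have "\<dots> \<le> 2 / \<epsilon>" using \<epsilon> by (simp add: field_simps power2_eq_square)
    finally have "\<epsilon> / 2 * (?P - 3 / 4 * ?Q) \<le> \<epsilon> / 2 * (2 / \<epsilon>)"
      using Q \<epsilon> by (intro mult_left_mono) auto
    then show ?thesis using \<epsilon> by (simp add: minorant_def)
  qed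
  moreover have "minorant \<epsilon> x \<le> 0" if "2 * \<epsilon> < dist_int x"
  proof -
    have "(2 * \<epsilon>)\<^sup>2 \<le> (dist_int x)\<^sup>2" using that assms by (intro power_mono) auto
    then have "32 * \<epsilon>\<^sup>2 \<le> 1 - cos (2 * pi * x)" using one_minus_cos_ge[of x] by (simp add: power_mult_distrib)
    moreover have "(1 / 2)\<^sup>2 \<le> (1 - \<epsilon>)\<^sup>2" using assms by (intro power_mono) auto
    ultimately have "(32 * \<epsilon>\<^sup>2) * (1 / 2)\<^sup>2 \<le> (1 - cos (2 * pi * x)) * (1 - \<epsilon>)\<^sup>2"
      by (intro mult_mono) auto
    then have "4 * (1 - (1 - \<epsilon>))\<^sup>2 \<le> (1 - cos (2 * pi * x)) * (1 - \<epsilon>)\<^sup>2"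
      by (simp add: power2_eq_square) (smt (verit) zero_le_square)
    then have "?P \<le> 3 / 4 * ?Q"
      using assms \<epsilon> by (intro poisson_kernel_square_compare(2)) auto
    then show ?thesis using \<epsilon> by (simp add: minorant_def mult_le_0_iff)
  qed
  ultimately show ?thesis by (auto simp: not_le)
qed (simp add: minorant_def)

section \<open>First and second moments in terms of the Fourier transform\<close>

lemma positive_fourier_series_norm_trig_sum_le:
  assumes "positive_fourier_series g a"
  shows "norm (trig_sum a K x) \<le> 2"
proof -
  have "norm (trig_sum a K x) \<le> (\<Sum>k = - int K..int K. norm (of_real (a k) * unit_exp (of_int k * x)))"
    unfolding trig_sum_def by (rule norm_sum)
  also have "\<dots> = (\<Sum>k = - int K..int K. a k)"
    using assms by (simp add: norm_mult positive_fourier_series_def)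
  also have "\<dots> \<le> 2" using assms by (simp add: positive_fourier_series_def)
  finally show ?thesis .
qed

lemma positive_fourier_series_abs_le:
  assumes "positive_fourier_series g a"
  shows "\<bar>g x\<bar> \<le> 2"
proof -
  have "(\<lambda>K. norm (trig_sum a K x)) \<longlonglongrightarrow> norm (of_real (g x) :: complex)"
    using assms by (intro tendsto_norm) (simp add: positive_fourier_series_def)
  then show ?thesis
    using positive_fourier_series_norm_trig_sum_le[OF assms]
    by (intro LIMSEQ_le_const2[of "\<lambda>K. norm (trig_sum a K x)"]) auto
qed

lemma trig_sum_measurable [measurable]: "trig_sum a K \<in> borel_measurable borel"
  unfolding trig_sum_def by measurable

lemma positive_fourier_series_measurable:
  assumes "positive_fourier_series g a"
  shows "g \<in> borel_measurable borel"
proof (rule borel_measurable_LIMSEQ_real)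
  show "(\<lambda>K. Re (trig_sum a K x)) \<longlonglongrightarrow> g x" for x
    using assms tendsto_Re by (fastforce simp: positive_fourier_series_def)
qed measurable

text \<open>
  Passing from Fourier series to finite trigonometric sums: an estimate for the partial sums that
  is uniform in their length survives in the limit, by dominated convergence.
\<close>
lemma (in prob_space) expectation_approx_by_limit:
  fixes F :: "nat \<Rightarrow> 'a \<Rightarrow> complex" and g :: "'a \<Rightarrow> real"
  assumes [measurable]: "\<And>K. F K \<in> borel_measurable M"
    and bounded: "\<And>K x. norm (F K x) \<le> D"
    and lim: "\<And>x. (\<lambda>K. F K x) \<longlonglongrightarrow> of_real (g x)"
    and approx: "\<And>K. norm ((LINT x|M. F K x) - of_real c) \<le> B"
  shows "\<bar>(LINT x|M. g x) - c\<bar> \<le> B"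
proof -
  have "g \<in> borel_measurable M"
  proof (rule borel_measurable_LIMSEQ_real)
    show "(\<lambda>K. Re (F K x)) \<longlonglongrightarrow> g x" for x
      using tendsto_Re[OF lim[of x]] by simp
  qed measurable
  then have "(\<lambda>K. LINT x|M. F K x) \<longlonglongrightarrow> (LINT x|M. complex_of_real (g x))"
    using lim bounded by (intro integral_dominated_convergence[where w = "\<lambda>_. D"]) auto
  then have "(\<lambda>K. norm ((LINT x|M. F K x) - of_real c)) \<longlonglongrightarrow> norm (of_real (LINT x|M. g x) - complex_of_real c)"
    by (intro tendsto_intros) (simp add: integral_complex_of_real)
  then have "norm (of_real (LINT x|M. g x) - complex_of_real c) \<le> B"
    using approx by (intro LIMSEQ_le_const2) auto
  then show ?thesis by (simp flip: of_real_diff)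
qed

definition phase :: "nat \<Rightarrow> real \<times> real \<Rightarrow> real" where
  "phase N p = real N * fst p - snd p"

lemma phase_measurable [measurable]: "phase N \<in> borel_measurable borel"
  unfolding phase_def by (intro borel_measurable_continuous_onI continuous_intros)

locale plane_prob = prob_space \<nu> for \<nu> :: "(real \<times> real) measure" +
  assumes sets_nu: "sets \<nu> = sets borel"
begin

lemma measurable_nu: "f \<in> borel_measurable borel \<Longrightarrow> f \<in> borel_measurable \<nu>"
  by (simp add: measurable_cong_sets[OF sets_nu refl])

lemma bounded_integrable:
  fixes f :: "real \<times> real \<Rightarrow> 'b :: {banach, second_countable_topology}"
  assumes "f \<in> borel_measurable borel" "\<And>x. norm (f x) \<le> D"
  shows "integrable \<nu> f"
  using assms measurable_nu by (intro integrable_const_bound[where B = D]) auto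

lemma fourier_zero: "fourier \<nu> (0, 0) = 1"
  by (simp add: fourier_def prob_space flip: zero_prod_def)

lemma norm_fourier_le: "norm (fourier \<nu> \<xi>) \<le> 1"
proof -
  have "norm (fourier \<nu> \<xi>) \<le> (LINT x|\<nu>. norm (unit_exp (- (\<xi> \<bullet> x))))"
    unfolding fourier_def by (rule integral_norm_bound)
  then show ?thesis by (simp add: prob_space)
qed

lemma character_measurable: "(\<lambda>x. unit_exp (- (\<xi> \<bullet> x))) \<in> borel_measurable borel"
  for \<xi> :: "real \<times> real"
  unfolding unit_exp_def by (intro borel_measurable_continuous_onI continuous_intros)

lemma character_integrable: "integrable \<nu> (\<lambda>x. unit_exp (- (\<xi> \<bullet> x)))"
  by (rule bounded_integrable[where D = 1]) (simp_all add: character_measurable)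

lemma first_moment:
  assumes g: "positive_fourier_series g a"
    and decay: "\<And>k. k \<noteq> 0 \<Longrightarrow> norm (fourier \<nu> (- (of_int k * real N), of_int k)) \<le> e"
    and e: "0 \<le> e"
  shows "\<bar>(LINT p|\<nu>. g (phase N p)) - a 0\<bar> \<le> 2 * e"
proof (rule expectation_approx_by_limit[where F = "\<lambda>K p. trig_sum a K (phase N p)" and D = 2])
  show "(\<lambda>p. trig_sum a K (phase N p)) \<in> borel_measurable \<nu>" for K
    by (rule measurable_nu) measurable
  show "norm (trig_sum a K (phase N p)) \<le> 2" for K p
    by (rule positive_fourier_series_norm_trig_sum_le[OF g])
  show "(\<lambda>K. trig_sum a K (phase N p)) \<longlonglongrightarrow> of_real (g (phase N p))" for p
    using g by (simp add: positive_fourier_series_def)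
  fix K
  let ?I = "{- int K..int K}" and ?\<xi> = "\<lambda>k. (- (real_of_int k * real N), real_of_int k)"
  have a: "a k \<ge> 0" "(\<Sum>k\<in>?I. a k) \<le> 2" for k
    using g by (auto simp: positive_fourier_series_def)
  have "unit_exp (of_int k * phase N p) = unit_exp (- (?\<xi> k \<bullet> p))" for k p
    by (simp add: phase_def inner_prod_def algebra_simps)
  then have "trig_sum a K (phase N p) = (\<Sum>k\<in>?I. of_real (a k) * unit_exp (- (?\<xi> k \<bullet> p)))" for p
    by (simp add: trig_sum_def)
  then have "(LINT p|\<nu>. trig_sum a K (phase N p)) =
      (LINT p|\<nu>. (\<Sum>k\<in>?I. of_real (a k) * unit_exp (- (?\<xi> k \<bullet> p))))"
    by (simp only:)
  also have "\<dots> = (\<Sum>k\<in>?I. (LINT p|\<nu>. of_real (a k) * unit_exp (- (?\<xi> k \<bullet> p))))"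
    by (intro Bochner_Integration.integral_sum integrable_mult_right character_integrable)
  finally have int: "(LINT p|\<nu>. trig_sum a K (phase N p)) = (\<Sum>k\<in>?I. of_real (a k) * fourier \<nu> (?\<xi> k))"
    by (simp only: fourier_def integral_mult_right_zero)
  have "of_real (a 0) = (\<Sum>k\<in>?I. of_real (if k = 0 then a k else 0) :: complex)"
    by (simp flip: of_real_sum)
  then have "(LINT p|\<nu>. trig_sum a K (phase N p)) - of_real (a 0)
      = (\<Sum>k\<in>?I. of_real (a k) * fourier \<nu> (?\<xi> k) - of_real (if k = 0 then a k else 0))"
    by (simp only: int sum_subtractf)
  also have "norm \<dots> \<le> (\<Sum>k\<in>?I. a k * e)"
  proof (rule sum_norm_le)
    show "norm (of_real (a k) * fourier \<nu> (?\<xi> k) - of_real (if k = 0 then a k else 0)) \<le> a k * e" for k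
      using a(1)[of k] decay[of k] e by (cases "k = 0") (auto simp: fourier_zero norm_mult mult_left_mono)
  qed
  also have "\<dots> \<le> 2 * e" unfolding sum_distrib_right[symmetric] using a e by (intro mult_right_mono) auto
  finally show "norm ((LINT p|\<nu>. trig_sum a K (phase N p)) - of_real (a 0)) \<le> 2 * e" .
qed

lemma second_moment:
  assumes g: "positive_fourier_series g a" and h: "positive_fourier_series h b"
    and off_diagonal: "\<And>K. (\<Sum>k = - int K..int K. \<Sum>l = - int K..int K. a k * b l *
          (if k = 0 \<and> l = 0 then 0
           else norm (fourier \<nu> (- (of_int k * real M + of_int l * real N), of_int (k + l))))) \<le> B"
  shows "\<bar>(LINT p|\<nu>. g (phase M p) * h (phase N p)) - a 0 * b 0\<bar> \<le> B"
proof (rule expectation_approx_by_limit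
    [where F = "\<lambda>K p. trig_sum a K (phase M p) * trig_sum b K (phase N p)" and D = "2 * 2"])
  show "(\<lambda>p. trig_sum a K (phase M p) * trig_sum b K (phase N p)) \<in> borel_measurable \<nu>" for K
    by (rule measurable_nu) measurable
  show "norm (trig_sum a K (phase M p) * trig_sum b K (phase N p)) \<le> 2 * 2" for K p
    unfolding norm_mult
    by (intro mult_mono positive_fourier_series_norm_trig_sum_le[OF g]
        positive_fourier_series_norm_trig_sum_le[OF h]) auto
  show "(\<lambda>K. trig_sum a K (phase M p) * trig_sum b K (phase N p))
      \<longlonglongrightarrow> of_real (g (phase M p) * h (phase N p))" for p
    unfolding of_real_mult using g h by (intro tendsto_mult) (auto simp: positive_fourier_series_def)
  fix K
  let ?I = "{- int K..int K}"
  let ?\<xi> = "\<lambda>k l. (- (real_of_int k * real M + real_of_int l * real N), real_of_int (k + l))"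
  have ab: "a k \<ge> 0" "b k \<ge> 0" for k using g h by (auto simp: positive_fourier_series_def)
  have "unit_exp (of_int k * phase M p) * unit_exp (of_int l * phase N p) = unit_exp (- (?\<xi> k l \<bullet> p))" for k l p
    unfolding unit_exp_add[symmetric] by (simp add: phase_def inner_prod_def algebra_simps)
  then have "of_real (a k) * unit_exp (of_int k * phase M p) * (of_real (b l) * unit_exp (of_int l * phase N p))
      = of_real (a k * b l) * unit_exp (- (?\<xi> k l \<bullet> p))" for k l p
    by (simp only: of_real_mult mult_ac flip: unit_exp_add)
  then have "trig_sum a K (phase M p) * trig_sum b K (phase N p) =
      (\<Sum>k\<in>?I. \<Sum>l\<in>?I. of_real (a k * b l) * unit_exp (- (?\<xi> k l \<bullet> p)))" for p
    by (simp only: trig_sum_def sum_product)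
  then have "(LINT p|\<nu>. trig_sum a K (phase M p) * trig_sum b K (phase N p)) =
      (LINT p|\<nu>. (\<Sum>k\<in>?I. \<Sum>l\<in>?I. of_real (a k * b l) * unit_exp (- (?\<xi> k l \<bullet> p))))"
    by (simp only:)
  also have "\<dots> = (\<Sum>k\<in>?I. (LINT p|\<nu>. (\<Sum>l\<in>?I. of_real (a k * b l) * unit_exp (- (?\<xi> k l \<bullet> p)))))"
    by (intro Bochner_Integration.integral_sum Bochner_Integration.integrable_sum integrable_mult_right character_integrable)
  also have "\<dots> = (\<Sum>k\<in>?I. \<Sum>l\<in>?I. (LINT p|\<nu>. of_real (a k * b l) * unit_exp (- (?\<xi> k l \<bullet> p))))"
    by (intro sum.cong refl Bochner_Integration.integral_sum integrable_mult_right character_integrable)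
  finally have int: "(LINT p|\<nu>. trig_sum a K (phase M p) * trig_sum b K (phase N p)) =
      (\<Sum>k\<in>?I. \<Sum>l\<in>?I. of_real (a k * b l) * fourier \<nu> (?\<xi> k l))"
    by (simp only: fourier_def integral_mult_right_zero)
  have "of_real (a 0 * b 0) = (\<Sum>k\<in>?I. if k = 0 then of_real (a 0 * b 0) else 0 :: complex)"
    by simp
  also have "\<dots> = (\<Sum>k\<in>?I. \<Sum>l\<in>?I. if k = 0 \<and> l = 0 then of_real (a k * b l) else 0)"
    by (intro sum.cong refl) simp
  finally have diff: "(LINT p|\<nu>. trig_sum a K (phase M p) * trig_sum b K (phase N p)) - of_real (a 0 * b 0)
      = (\<Sum>k\<in>?I. \<Sum>l\<in>?I. of_real (a k * b l) * fourier \<nu> (?\<xi> k l) -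
          (if k = 0 \<and> l = 0 then of_real (a k * b l) else 0))"
    by (simp only: int sum_subtractf)
  have "norm ((LINT p|\<nu>. trig_sum a K (phase M p) * trig_sum b K (phase N p)) - of_real (a 0 * b 0))
      \<le> (\<Sum>k\<in>?I. \<Sum>l\<in>?I. a k * b l * (if k = 0 \<and> l = 0 then 0 else norm (fourier \<nu> (?\<xi> k l))))"
    unfolding diff
  proof (intro sum_norm_le)
    show "norm (of_real (a k * b l) * fourier \<nu> (?\<xi> k l) - (if k = 0 \<and> l = 0 then of_real (a k * b l) else 0))
      \<le> a k * b l * (if k = 0 \<and> l = 0 then 0 else norm (fourier \<nu> (?\<xi> k l)))" for k l
      using ab by (auto simp: fourier_zero norm_mult)
  qed
  also have "\<dots> \<le> B" using off_diagonal[of K] .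
  finally show "norm ((LINT p|\<nu>. trig_sum a K (phase M p) * trig_sum b K (phase N p)) - of_real (a 0 * b 0)) \<le> B" .
qed

end

section \<open>Correlation of two minorants\<close>

text \<open>
  The frequencies at which the Fourier transform of the measure cannot be controlled when functions
  of \<open>phase M\<close> and \<open>phase N\<close> are correlated.
\<close>
definition low_frequency :: "nat \<Rightarrow> nat \<Rightarrow> real \<Rightarrow> int \<Rightarrow> int \<Rightarrow> bool" where
  "low_frequency M N Y k l \<longleftrightarrow>
     max_norm (- (of_int k * real M + of_int l * real N), of_int (k + l)) < Y"

text \<open>
  Near-cancellation of \<open>k M\<close> and \<open>l N\<close> forces \<open>k\<close> to be larger than \<open>l\<close> by about the
  factor \<open>N / M\<close>.
\<close>
lemma low_frequency_ratio:
  assumes "low_frequency M N Y k l" "l \<noteq> 0" "Y \<le> real N / 2"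
  shows "\<bar>real_of_int l\<bar> * real N \<le> 2 * \<bar>real_of_int k\<bar> * real M"
proof -
  have "\<bar>of_int k * real M + of_int l * real N\<bar> < Y"
    using assms(1) by (auto simp: low_frequency_def max_norm_def)
  then have "\<bar>of_int l * real N\<bar> \<le> \<bar>of_int k * real M\<bar> + real N / 2" using assms(3) by linarith
  moreover have "1 * real N \<le> \<bar>real_of_int l\<bar> * real N" using assms(2) by (intro mult_right_mono) auto
  ultimately show ?thesis by (simp add: abs_mult)
qed

text \<open>
  If \<open>k + l\<close> is small as well, then \<open>\<bar>k\<bar> = O(Y)\<close>, because up to \<open>O(Y)\<close> the
  number \<open>\<bar>l\<bar>\<close> is smaller than \<open>\<bar>k\<bar>\<close> by the fixed factor \<open>c\<close>.  As \<open>\<bar>k\<bar>\<close> is at least of order \<open>N / M\<close>, this makes \<open>M\<close> at least of order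
  \<open>N / Y\<close>, hence larger than \<open>2 Y\<close> when \<open>Y\<^sup>2\<close> is a small multiple of \<open>N\<close>.  But the condition
  \<open>\<bar>k M + l N\<bar> < Y\<close> confines \<open>k M\<close> to an interval of length \<open>2 Y\<close>.
\<close>
lemma low_frequency_unique:
  assumes low: "low_frequency M N Y k l" "low_frequency M N Y k' l" and "l \<noteq> 0"
    and c: "1 < c" "c * real M \<le> real N" "M > 0"
    and Y: "8 * Y\<^sup>2 \<le> (1 - 1 / c) * real N" "Y \<le> real N / 2"
  shows "k = k'"
proof (rule ccontr)
  assume "k \<noteq> k'"
  have 1: "\<bar>of_int k * real M + of_int l * real N\<bar> < Y" "\<bar>of_int k' * real M + of_int l * real N\<bar> < Y"
      "\<bar>real_of_int k + real_of_int l\<bar> < Y"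
    using low by (auto simp: low_frequency_def max_norm_def)
  have N: "real N > 0" using c by (smt (verit) mult_pos_pos of_nat_0_less_iff)
  have "\<bar>real_of_int k\<bar> * (1 - 1 / c) \<le> 2 * Y"
  proof -
    have "\<bar>real_of_int l\<bar> * real N \<le> \<bar>real_of_int k\<bar> * real M + Y" 
      using 1(1) abs_mult[of "real_of_int l" "real N"] abs_mult[of "real_of_int k" "real M"]
      by (simp only: abs_of_nat)
    also have "\<dots> \<le> \<bar>real_of_int k\<bar> * (real N / c) + Y * real N"
    proof (intro add_mono mult_left_mono)
      show "real M \<le> real N / c" using c by (simp add: field_simps)
      show "Y \<le> Y * real N" using mult_left_mono[of 1 "real N" Y] N 1(1) by simp
    qed auto
    finally have "\<bar>real_of_int l\<bar> * real N \<le> (\<bar>real_of_int k\<bar> / c + Y) * real N" by (simp add: algebra_simps)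
    then have "\<bar>real_of_int l\<bar> \<le> \<bar>real_of_int k\<bar> / c + Y" using N by simp
    then show ?thesis using 1(3) by (simp add: algebra_simps)
  qed
  then have "\<bar>real_of_int k\<bar> * (1 - 1 / c) * (2 * real M) \<le> 2 * Y * (2 * real M)"
    by (intro mult_right_mono) auto
  moreover have "1 * real N * (1 - 1 / c) \<le> (2 * \<bar>real_of_int k\<bar> * real M) * (1 - 1 / c)"
  proof (rule mult_right_mono, rule order_trans[OF _ low_frequency_ratio[OF low(1) assms(3) Y(2)]])
    show "1 * real N \<le> \<bar>real_of_int l\<bar> * real N" using assms(3) by (intro mult_right_mono) auto
  qed (use c in simp)
  ultimately have "real N * (1 - 1 / c) \<le> 4 * Y * real M" by (simp add: mult_ac)
  moreover have "real M < 2 * Y"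
  proof -
    have "1 * real M \<le> \<bar>real_of_int (k - k')\<bar> * real M" using \<open>k \<noteq> k'\<close> by (intro mult_right_mono) linarith+
    also have "\<dots> = \<bar>(of_int k * real M + of_int l * real N) - (of_int k' * real M + of_int l * real N)\<bar>"
      using abs_mult[of "real_of_int (k - k')" "real M"] by (simp add: left_diff_distrib)
    also have "\<dots> < 2 * Y" using 1 by linarith
    finally show ?thesis by simp
  qed
  then have "4 * Y * real M < 4 * Y * (2 * Y)" using c by (intro mult_strict_left_mono) auto
  ultimately show False using Y(1) by (simp add: power2_eq_square mult_ac)
qed

text \<open>
  By uniqueness the inner sum is a single coefficient, at a place of size \<open>\<bar>l\<bar> N / (2 M)\<close> or more;
  the geometric series over \<open>l\<close> has ratio \<open>exp (- \<epsilon> N / (2 M))\<close>, and the factor \<open>\<epsilon>\<close> of the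
  coefficients makes the bound independent of \<open>\<epsilon>\<close>.
\<close>
lemma low_frequency_sum_le:
  assumes c: "1 < c" "c * real M \<le> real N" "M > 0"
    and Y: "8 * Y\<^sup>2 \<le> (1 - 1 / c) * real N" "Y \<le> real N / 2"
    and a: "\<And>k. 0 \<le> a k" "\<And>k. a k \<le> majorant_coeff \<epsilon> k / 2" and \<epsilon>: "0 \<le> \<epsilon>" "\<epsilon> \<le> 1"
  shows "(\<Sum>l = - int K..int K. \<Sum>k = - int K..int K. if l \<noteq> 0 \<and> low_frequency M N Y k l then a k else 0)
           \<le> 2 * real M / real N"
proof (cases "\<epsilon> = 0")
  case True
  then have "a k = 0" for k using a(1)[of k] a(2)[of k] by (simp add: majorant_coeff_def)
  then have "(\<Sum>l = - int K..int K. \<Sum>k = - int K..int K. if l \<noteq> 0 \<and> low_frequency M N Y k l then a k else 0) = 0"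
    by (intro sum.neutral ballI) simp
  then show ?thesis by simp
next
  case False
  then have \<epsilon>0: "\<epsilon> > 0" using \<epsilon> by simp
  have N: "real N > 0" using c by (smt (verit) mult_pos_pos of_nat_0_less_iff)
  define q where "q = \<epsilon> * real N / (2 * real M)"
  define y where "y = exp (- q)"
  have q: "q > 0" using N c \<epsilon>0 by (simp add: q_def)
  have y: "0 < y" "y < 1" using q by (auto simp: y_def)
  have inner: "(\<Sum>k = - int K..int K. if l \<noteq> 0 \<and> low_frequency M N Y k l then a k else 0)
      \<le> (if l = 0 then 0 else \<epsilon> / 2 * y ^ nat \<bar>l\<bar>)" for l
  proof (cases "l \<noteq> 0 \<and> (\<exists>k. low_frequency M N Y k l)")
    case True
    then obtain k0 where k0: "low_frequency M N Y k0 l" and l: "l \<noteq> 0" by auto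
    have unique: "low_frequency M N Y k l \<longleftrightarrow> k = k0" for k
      using low_frequency_unique[OF _ k0 l c Y] k0 by metis
    have "(\<Sum>k = - int K..int K. if l \<noteq> 0 \<and> low_frequency M N Y k l then a k else 0)
        = (\<Sum>k = - int K..int K. if k = k0 then a k0 else 0)"
      unfolding unique using l by (intro sum.cong refl) simp
    also have "\<dots> \<le> a k0" using a(1)[of k0] by simp
    also have "\<dots> \<le> \<epsilon> / 2 * (1 - \<epsilon>) ^ nat \<bar>k0\<bar>" using a(2)[of k0] by (simp add: majorant_coeff_def)
    also have "\<dots> \<le> \<epsilon> / 2 * exp (- \<epsilon>) ^ nat \<bar>k0\<bar>"
      using \<epsilon> exp_ge_add_one_self[of "- \<epsilon>"] by (intro mult_left_mono power_mono) auto
    also have "exp (- \<epsilon>) ^ nat \<bar>k0\<bar> = exp (- (\<epsilon> * \<bar>real_of_int k0\<bar>))"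
      using exp_of_nat_mult[of "nat \<bar>k0\<bar>" "- \<epsilon>"] by (simp add: mult_ac)
    also have "\<dots> \<le> exp (- (q * \<bar>real_of_int l\<bar>))"
    proof -
      have "\<bar>real_of_int l\<bar> * real N / (2 * real M) \<le> \<bar>real_of_int k0\<bar>"
        using low_frequency_ratio[OF k0 l Y(2)] c by (simp add: field_simps)
      from mult_left_mono[OF this, of \<epsilon>] show ?thesis using \<epsilon> by (simp add: q_def mult_ac)
    qed
    also have "\<dots> = y ^ nat \<bar>l\<bar>" 
      using exp_of_nat_mult[of "nat \<bar>l\<bar>" "- q"] by (simp add: y_def mult_ac)
    finally show ?thesis using l \<epsilon>0 by simp
  next
    case False
    then have "(\<Sum>k = - int K..int K. if l \<noteq> 0 \<and> low_frequency M N Y k l then a k else 0) = 0"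
      by (intro sum.neutral) auto
    then show ?thesis using \<epsilon>0 y by simp
  qed
  have "(\<Sum>l = - int K..int K. \<Sum>k = - int K..int K. if l \<noteq> 0 \<and> low_frequency M N Y k l then a k else 0)
      \<le> (\<Sum>l = - int K..int K. if l = 0 then 0 else \<epsilon> / 2 * y ^ nat \<bar>l\<bar>)"
    by (intro sum_mono inner)
  also have "\<dots> = \<epsilon> * y * (\<Sum>j<K. y ^ j)"
    by (simp add: sum_symmetric_int_interval sum_distrib_left nat_add_distrib mult_ac)
  also have "\<dots> \<le> \<epsilon> * y * (1 / (1 - y))"
  proof (intro mult_left_mono)
    have "(1 - y) * (\<Sum>j<K. y ^ j) \<le> 1" using y by (simp add: one_diff_power_eq[symmetric])
    then show "(\<Sum>j<K. y ^ j) \<le> 1 / (1 - y)" using y by (simp add: field_simps)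
  qed (use \<epsilon> y in auto)
  also have "\<dots> \<le> \<epsilon> * (1 / q)"
  proof -
    have "y * q \<le> 1 - y"
    proof -
      have "y * (1 + q) \<le> y * exp q" using y by (intro mult_left_mono exp_ge_add_one_self) auto
      also have "\<dots> = 1" by (simp add: y_def flip: exp_add)
      finally show ?thesis by (simp add: algebra_simps)
    qed
    then have "y * (1 / (1 - y)) \<le> 1 / q" using y q by (simp add: field_simps)
    from mult_left_mono[OF this, of \<epsilon>] show ?thesis using \<epsilon> by (simp add: mult_ac)
  qed
  also have "\<dots> = 2 * real M / real N" using \<epsilon>0 c by (simp add: q_def)
  finally show ?thesis .
qed

context plane_prob
begin

text \<open>
  The three error terms belong to the frequencies that are not low, to those with \<open>l = 0\<close>, and to
  the low ones with \<open>l \<noteq> 0\<close>, where the trivial bound 1 for the Fourier transform is used.  In the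
  last two cases the factor \<open>\<delta>\<close> bounds the coefficients of the second minorant.
\<close>
lemma minorant_correlation:
  assumes c: "1 < c" "c * real M \<le> real N" "M > 0"
    and Y: "8 * Y\<^sup>2 \<le> (1 - 1 / c) * real N" "Y \<le> real N / 2"
    and \<epsilon>: "0 \<le> \<epsilon>" "\<epsilon> \<le> 1" and \<delta>: "0 \<le> \<delta>" "\<delta> \<le> 1"
    and e1: "\<And>k. k \<noteq> 0 \<Longrightarrow> norm (fourier \<nu> (- (of_int k * real M), of_int k)) \<le> e1"
    and e2: "\<And>k l. \<not> low_frequency M N Y k l \<Longrightarrow>
        norm (fourier \<nu> (- (of_int k * real M + of_int l * real N), of_int (k + l))) \<le> e2"
    and e: "0 \<le> e1" "0 \<le> e2"
  shows "\<bar>(LINT p|\<nu>. minorant \<epsilon> (phase M p) * minorant \<delta> (phase N p)) - (\<epsilon> / 8) * (\<delta> / 8)\<bar>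
           \<le> 4 * e2 + \<delta> * e1 + \<delta> * (real M / real N)"
proof -
  let ?a = "minorant_coeff \<epsilon>" and ?b = "minorant_coeff \<delta>"
  have "\<bar>(LINT p|\<nu>. minorant \<epsilon> (phase M p) * minorant \<delta> (phase N p)) - ?a 0 * ?b 0\<bar>
      \<le> 4 * e2 + \<delta> * e1 + \<delta> * (real M / real N)"
  proof (rule second_moment)
    show fa: "positive_fourier_series (minorant \<epsilon>) ?a" and fb: "positive_fourier_series (minorant \<delta>) ?b"
      using \<epsilon> \<delta> by (auto intro: positive_fourier_series_minorant)
    fix K
    let ?I = "{- int K..int K}"
    let ?w = "\<lambda>k l. if k = 0 \<and> l = 0 then 0
           else norm (fourier \<nu> (- (of_int k * real M + of_int l * real N), of_int (k + l)))"
    have a: "0 \<le> ?a k" "(\<Sum>k\<in>?I. ?a k) \<le> 2" for k using fa by (auto simp: positive_fourier_series_def)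
    have b: "0 \<le> ?b k" "(\<Sum>k\<in>?I. ?b k) \<le> 2" for k using fb by (auto simp: positive_fourier_series_def)
    have b_le: "?b l \<le> \<delta> / 2" for l
    proof -
      have "?b l \<le> \<delta> * (1 - \<delta>) ^ nat \<bar>l\<bar> / 2"
        using minorant_coeff_bounds(2)[OF \<delta>, of l] by (simp add: majorant_coeff_def)
      also have "\<dots> \<le> \<delta> * 1 / 2"
        using \<delta> by (intro divide_right_mono mult_left_mono power_le_one) auto
      finally show ?thesis by simp
    qed
    have w: "?w k l \<le> e2 + (if l = 0 then e1 else 0) + (if l \<noteq> 0 \<and> low_frequency M N Y k l then 1 else 0)" for k l
    proof (cases "low_frequency M N Y k l")
      case True
      then show ?thesis using e e1[of k] norm_fourier_le by (auto simp: add_increasing)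
    next
      case False
      then show ?thesis using e e2[of k l] by auto
    qed
    have "(\<Sum>k\<in>?I. \<Sum>l\<in>?I. ?a k * ?b l * ?w k l) \<le>
        (\<Sum>k\<in>?I. \<Sum>l\<in>?I. ?a k * ?b l * e2 + (if l = 0 then ?a k * (\<delta> / 2) * e1 else 0)
          + \<delta> / 2 * (if l \<noteq> 0 \<and> low_frequency M N Y k l then ?a k else 0))"
    proof (intro sum_mono)
      fix k l
      have "?a k * ?b l * ?w k l \<le> ?a k * ?b l *
         (e2 + (if l = 0 then e1 else 0) + (if l \<noteq> 0 \<and> low_frequency M N Y k l then 1 else 0))"
        using a b by (intro mult_left_mono[OF w]) auto
      also have "\<dots> = ?a k * ?b l * e2 + ?a k * ?b l * ((if l = 0 then e1 else 0)
          + (if l \<noteq> 0 \<and> low_frequency M N Y k l then 1 else 0))" by (simp add: algebra_simps)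
      also have "\<dots> \<le> ?a k * ?b l * e2 + ?a k * (\<delta> / 2) * ((if l = 0 then e1 else 0)
          + (if l \<noteq> 0 \<and> low_frequency M N Y k l then 1 else 0))"
        using a(1)[of k] b_le[of l] e by (intro add_left_mono mult_right_mono mult_left_mono) auto
      finally show "?a k * ?b l * ?w k l \<le> ?a k * ?b l * e2 + (if l = 0 then ?a k * (\<delta> / 2) * e1 else 0)
          + \<delta> / 2 * (if l \<noteq> 0 \<and> low_frequency M N Y k l then ?a k else 0)"
        by (auto split: if_splits simp: algebra_simps)
    qed
    also have "\<dots> = (\<Sum>k\<in>?I. ?a k) * (\<Sum>l\<in>?I. ?b l) * e2 + (\<Sum>k\<in>?I. ?a k) * (\<delta> / 2) * e1
        + \<delta> / 2 * (\<Sum>l\<in>?I. \<Sum>k\<in>?I. if l \<noteq> 0 \<and> low_frequency M N Y k l then ?a k else 0)"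
    proof -
      have "(\<Sum>k\<in>?I. \<Sum>l\<in>?I. if l \<noteq> 0 \<and> low_frequency M N Y k l then ?a k else 0)
          = (\<Sum>l\<in>?I. \<Sum>k\<in>?I. if l \<noteq> 0 \<and> low_frequency M N Y k l then ?a k else 0)"
        by (rule sum.swap)
      then have "(\<Sum>k\<in>?I. \<Sum>l\<in>?I. \<delta> / 2 * (if l \<noteq> 0 \<and> low_frequency M N Y k l then ?a k else 0))
          = \<delta> / 2 * (\<Sum>l\<in>?I. \<Sum>k\<in>?I. if l \<noteq> 0 \<and> low_frequency M N Y k l then ?a k else 0)"
        by (simp only: sum_distrib_left[symmetric])
      moreover have "(\<Sum>k\<in>?I. \<Sum>l\<in>?I. ?a k * ?b l * e2) = (\<Sum>k\<in>?I. ?a k) * (\<Sum>l\<in>?I. ?b l) * e2"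
        by (subst sum_product) (simp only: sum_distrib_right)
      moreover have "(\<Sum>k\<in>?I. \<Sum>l\<in>?I. if l = 0 then ?a k * (\<delta> / 2) * e1 else 0) = (\<Sum>k\<in>?I. ?a k) * (\<delta> / 2) * e1"
      proof -
        have "(\<Sum>l\<in>?I. if l = 0 then ?a k * (\<delta> / 2) * e1 else 0) = ?a k * (\<delta> / 2) * e1" for k by simp
        then show ?thesis by (simp only: sum_distrib_right)
      qed
      ultimately show ?thesis by (simp only: sum.distrib)
    qed
    also have "\<dots> \<le> 2 * 2 * e2 + 2 * (\<delta> / 2) * e1 + \<delta> / 2 * (2 * real M / real N)"
    proof (intro add_mono)
      have "(\<Sum>k\<in>?I. ?a k) * (\<Sum>l\<in>?I. ?b l) \<le> 2 * 2"
        using a b by (intro mult_mono sum_nonneg) auto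
      then show "(\<Sum>k\<in>?I. ?a k) * (\<Sum>l\<in>?I. ?b l) * e2 \<le> 2 * 2 * e2"
        by (rule mult_right_mono) (rule e)
      show "(\<Sum>k\<in>?I. ?a k) * (\<delta> / 2) * e1 \<le> 2 * (\<delta> / 2) * e1"
        using a(2) \<delta> e by (intro mult_right_mono) auto
      show "\<delta> / 2 * (\<Sum>l\<in>?I. \<Sum>k\<in>?I. if l \<noteq> 0 \<and> low_frequency M N Y k l then ?a k else 0)
          \<le> \<delta> / 2 * (2 * real M / real N)"
        using \<delta> minorant_coeff_bounds[OF \<epsilon>]
        by (intro mult_left_mono low_frequency_sum_le[OF c Y _ _ \<epsilon>]) auto
    qed
    finally show "(\<Sum>k\<in>?I. \<Sum>l\<in>?I. ?a k * ?b l * ?w k l) \<le> 4 * e2 + \<delta> * e1 + \<delta> * (real M / real N)"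
      by simp
  qed
  then show ?thesis by (simp add: minorant_coeff_def)
qed

end

section \<open>Decay along exponentially growing frequencies\<close>

lemma (in plane_prob) fourier_decay_geometric:
  assumes decay: "log_decay \<nu> A" "0 < A" and b: "1 < b" and \<kappa>: "0 < \<kappa>"
  obtains C where "0 \<le> C"
    and "\<And>t \<xi>. \<xi> \<in> \<int> \<times> \<int> \<Longrightarrow> \<kappa> * b ^ t \<le> max_norm \<xi> \<Longrightarrow>
           norm (fourier \<nu> \<xi>) \<le> C * real (t + 1) powr (- A)"
proof -
  from decay(1) obtain C0 R where C0: "0 < C0"
    and R: "\<And>\<xi>. \<xi> \<in> \<int> \<times> \<int> \<Longrightarrow> R \<le> max_norm \<xi> \<Longrightarrow> norm (fourier \<nu> \<xi>) \<le> C0 * ln (max_norm \<xi>) powr (- A)"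
    unfolding log_decay_def by blast
  define s where "s = sqrt b"
  have s: "1 < s" "b = s * s" using b by (auto simp: s_def)
  \<comment> \<open>From \<open>t0\<close> on, one factor \<open>s ^ t\<close> of \<open>b ^ t\<close> absorbs \<open>\<kappa>\<close> and the threshold \<open>R\<close>; the
    other one leaves a logarithm proportional to \<open>t + 1\<close>.\<close>
  obtain t0 where t0: "max (s / \<kappa>) R < s ^ t0" using real_arch_pow[OF s(1)] by blast
  define C where "C = C0 * ln s powr (- A) + real (t0 + 1) powr A"
  show thesis
  proof (rule that[of C])
    show "0 \<le> C" using C0 by (simp add: C_def)
    fix t \<xi>
    assume \<xi>: "\<xi> \<in> \<int> \<times> \<int>" and large: "\<kappa> * b ^ t \<le> max_norm \<xi>"
    show "norm (fourier \<nu> \<xi>) \<le> C * real (t + 1) powr (- A)"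
    proof (cases "t < t0")
      case True
      have "norm (fourier \<nu> \<xi>) \<le> real (t0 + 1) powr A * real (t0 + 1) powr (- A)"
        using norm_fourier_le by (simp flip: powr_add)
      also have "\<dots> \<le> C * real (t + 1) powr (- A)"
        unfolding C_def using True C0 decay(2) by (intro mult_mono powr_mono2') auto
      finally show ?thesis .
    next
      case False
      then have "s ^ t0 \<le> s ^ t" using s by (intro power_increasing) auto
      then have st: "s / \<kappa> \<le> s ^ t" "R \<le> s ^ t" using t0 by auto
      have "s * s ^ t = \<kappa> * (s / \<kappa>) * s ^ t" using \<kappa> by simp
      also have "\<dots> \<le> \<kappa> * s ^ t * s ^ t"
        using \<kappa> s st by (intro mult_right_mono mult_left_mono) auto
      also have "\<dots> \<le> max_norm \<xi>" using large by (simp add: s(2) power_mult_distrib)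
      finally have N: "s ^ (t + 1) \<le> max_norm \<xi>" by simp
      have "s ^ t \<le> s ^ (t + 1)" using s by (intro power_increasing) auto
      then have "norm (fourier \<nu> \<xi>) \<le> C0 * ln (max_norm \<xi>) powr (- A)"
        using N st by (intro R \<xi>) auto
      also have "ln (max_norm \<xi>) powr (- A) \<le> (real (t + 1) * ln s) powr (- A)"
      proof (intro powr_mono2')
        have "0 < s ^ (t + 1)" using s by simp
        then have "ln (s ^ (t + 1)) \<le> ln (max_norm \<xi>)" using N by (intro ln_mono) auto
        moreover have "ln (s ^ (t + 1)) = real (t + 1) * ln s" using s ln_realpow[of s "t + 1"] by simp
        ultimately show "real (t + 1) * ln s \<le> ln (max_norm \<xi>)" by simp
      qed (use s decay(2) in auto)
      also have "\<dots> = real (t + 1) powr (- A) * ln s powr (- A)"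
        using s by (simp add: powr_mult)
      also have "C0 * (real (t + 1) powr (- A) * ln s powr (- A)) \<le> C * real (t + 1) powr (- A)"
        by (simp add: C_def algebra_simps)
      finally show ?thesis using C0 by simp
    qed
  qed
qed

section \<open>Infinitely many events by a variance bound\<close>

text \<open>
  Induction on the number of terms: adding \<open>g T\<close> adds its second moment and twice its
  correlations with the earlier terms.
\<close>
lemma (in prob_space) expectation_square_sum_le:
  fixes g :: "nat \<Rightarrow> 'a \<Rightarrow> real"
  assumes [measurable]: "\<And>t. g t \<in> borel_measurable M"
    and bounded: "\<And>t x. \<bar>g t x\<bar> \<le> D"
    and v: "\<And>t. (LINT x|M. (g t x)\<^sup>2) + 2 * (\<Sum>s<t. \<bar>LINT x|M. g s x * g t x\<bar>) \<le> v t"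
  shows "(LINT x|M. (\<Sum>t<T. g t x)\<^sup>2) \<le> (\<Sum>t<T. v t)"
proof (induction T)
  case (Suc T)
  have int: "integrable M (\<lambda>x. g s x * g t x)" for s t
    by (rule integrable_const_bound[where B = "D * D"])
      (use bounded in \<open>auto simp: abs_mult intro!: mult_mono order_trans[OF abs_ge_zero bounded]\<close>)
  have sq: "(\<Sum>t<T. g t x)\<^sup>2 = (\<Sum>s<T. \<Sum>t<T. g s x * g t x)" for x
    by (simp add: power2_eq_square sum_product)
  have int_sq: "integrable M (\<lambda>x. (\<Sum>t<T. g t x)\<^sup>2)"
    unfolding sq by (intro Bochner_Integration.integrable_sum int)
  have "(\<Sum>t<Suc T. g t x)\<^sup>2 = (\<Sum>t<T. g t x)\<^sup>2 + (g T x * g T x + 2 * (\<Sum>s<T. g s x * g T x))" for x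
    unfolding sum_distrib_right[symmetric] by (simp add: power2_eq_square algebra_simps)
  then have "(LINT x|M. (\<Sum>t<Suc T. g t x)\<^sup>2) =
      (LINT x|M. (\<Sum>t<T. g t x)\<^sup>2 + (g T x * g T x + 2 * (\<Sum>s<T. g s x * g T x)))"
    by (simp only:)
  also have "\<dots> = (LINT x|M. (\<Sum>t<T. g t x)\<^sup>2)
      + ((LINT x|M. g T x * g T x) + 2 * (\<Sum>s<T. LINT x|M. g s x * g T x))"
    by (simp add: int int_sq)
  also have "(\<Sum>s<T. LINT x|M. g s x * g T x) \<le> (\<Sum>s<T. \<bar>LINT x|M. g s x * g T x\<bar>)"
    by (intro sum_mono) simp
  also have "(LINT x|M. (\<Sum>t<T. g t x)\<^sup>2)
      + ((LINT x|M. g T x * g T x) + 2 * (\<Sum>s<T. \<bar>LINT x|M. g s x * g T x\<bar>)) \<le> (\<Sum>t<T. v t) + v T"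
    using v[of T] by (intro add_mono Suc) (simp add: power2_eq_square)
  finally show ?case by simp
qed simp

text \<open>
  On the event that at most \<open>K\<close> of the sets occur, the partial sums of the minorants stay below
  \<open>K\<close> and hence deviate from their diverging means by at least half of them; Chebyshev's
  inequality gives this event measure zero.
\<close>
lemma (in prob_space) AE_infinitely_often_if_variance_small:
  fixes h :: "nat \<Rightarrow> 'a \<Rightarrow> real" and \<mu> :: "nat \<Rightarrow> real"
  assumes E [measurable]: "\<And>t. E t \<in> events"
    and h [measurable]: "\<And>t. h t \<in> borel_measurable M"
    and bounded: "\<And>t x. \<bar>h t x\<bar> \<le> D"
    and minor: "\<And>t x. h t x \<le> indicator (E t) x"
    and diverge: "filterlim (\<lambda>T. \<Sum>t<T. \<mu> t) at_top sequentially"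
    and var: "\<And>T. (LINT x|M. (\<Sum>t<T. h t x - \<mu> t)\<^sup>2) \<le> C * ((\<Sum>t<T. \<mu> t) + 1)"
  shows "AE x in M. infinite {t. x \<in> E t}"
proof -
  define m where "m T = (\<Sum>t<T. \<mu> t)" for T
  define B where "B K = {x \<in> space M. \<forall>T. (\<Sum>t<T. indicator (E t) x) \<le> real K}" for K :: nat
  have B [measurable]: "B K \<in> events" for K unfolding B_def by measurable
  have null: "prob (B K) = 0" for K
  proof -
    have le: "prob (B K) * (m T + 1) \<le> 4 * C" if T: "2 * real K + 1 \<le> m T" for T
    proof -
      let ?X = "\<lambda>x. \<Sum>t<T. h t x - \<mu> t"
      have int: "integrable M (\<lambda>x. (?X x)\<^sup>2)"
      proof (rule integrable_const_bound[where B = "(\<Sum>t<T. D + \<bar>\<mu> t\<bar>)\<^sup>2"])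
        have "\<bar>?X x\<bar> \<le> (\<Sum>t<T. D + \<bar>\<mu> t\<bar>)" for x
        proof (rule order_trans[OF sum_abs sum_mono])
          show "\<bar>h t x - \<mu> t\<bar> \<le> D + \<bar>\<mu> t\<bar>" for t using bounded[of t x] by linarith
        qed
        then show "AE x in M. norm ((?X x)\<^sup>2) \<le> (\<Sum>t<T. D + \<bar>\<mu> t\<bar>)\<^sup>2"
          using power_mono[OF _ abs_ge_zero, of _ _ 2] by (intro AE_I2) fastforce
      qed measurable
      have "prob (B K) * ((m T + 1) / 2)\<^sup>2 = (LINT x|M. indicator (B K) x * ((m T + 1) / 2)\<^sup>2)"
        using sets.Int_space_eq2[OF B[of K]] by simp
      also have "\<dots> \<le> (LINT x|M. (?X x)\<^sup>2)"
      proof (rule integral_mono[OF _ int])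
        fix x
        show "indicator (B K) x * ((m T + 1) / 2)\<^sup>2 \<le> (?X x)\<^sup>2"
        proof (cases "x \<in> B K")
          case True
          have "(\<Sum>t<T. h t x) \<le> (\<Sum>t<T. indicator (E t) x)" by (intro sum_mono minor)
          also have "\<dots> \<le> real K" using True by (simp add: B_def)
          finally have "(m T + 1) / 2 \<le> - ?X x"
            using T by (simp add: sum_subtractf m_def)
          then have "((m T + 1) / 2)\<^sup>2 \<le> (- ?X x)\<^sup>2" using T by (intro power_mono) auto
          then show ?thesis using True by simp
        qed simp
      qed (intro integrable_mult_left integrable_real_indicator; simp add: emeasure_eq_measure)
      also have "\<dots> \<le> C * (m T + 1)" using var by (simp add: m_def)
      finally have "prob (B K) * (m T + 1) * (m T + 1) \<le> 4 * C * (m T + 1)"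
        by (simp add: power2_eq_square field_simps)
      then show ?thesis using T by (simp add: mult_le_cancel_right)
    qed
    show ?thesis
    proof (rule ccontr)
      assume "prob (B K) \<noteq> 0"
      then have p: "0 < prob (B K)" by (simp add: zero_less_measure_iff)
      have "eventually (\<lambda>T. max (2 * real K + 1) (4 * C / prob (B K)) \<le> m T) sequentially"
        using diverge unfolding filterlim_at_top m_def by blast
      then obtain T where T: "2 * real K + 1 \<le> m T" "4 * C / prob (B K) \<le> m T"
        unfolding eventually_sequentially by auto
      then have "4 * C \<le> prob (B K) * m T" using p by (simp add: field_simps)
      with le[OF T(1)] p show False by (simp add: algebra_simps)
    qed
  qed
  have "AE x in M. \<forall>K. x \<notin> B K"
    unfolding AE_all_countable using null B
    by (intro allI AE_not_in) (auto simp: null_sets_def emeasure_eq_measure)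
  with AE_space[of M] show ?thesis
  proof eventually_elim
    case x: (elim x)
    show ?case
    proof
      assume fin: "finite {t. x \<in> E t}"
      have "(\<Sum>t<T. indicator (E t) x) \<le> real (card {t. x \<in> E t})" for T
      proof -
        have "(\<Sum>t<T. indicator (E t) x) = real (card {t \<in> {..<T}. x \<in> E t})"
          by (simp add: indicator_def of_bool_def sum.If_cases Int_def)
        also have "\<dots> \<le> real (card {t. x \<in> E t})"
          using fin by (intro of_nat_mono card_mono) auto
        finally show ?thesis .
      qed
      then have "x \<in> B (card {t. x \<in> E t})" using x by (simp add: B_def)
      with x show False by blast
    qed
  qed
qed

section \<open>The two halves of the zero-one law\<close>

lemma summable_if_index_times_summable:
  fixes e :: "nat \<Rightarrow> real"
  assumes "\<And>t. 0 \<le> e t" "summable (\<lambda>t. real (t + 1) * e t)"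
  shows "summable e"
proof (rule summable_comparison_test'[OF assms(2)])
  show "norm (e t) \<le> real (t + 1) * e t" for t
    using assms(1)[of t] by (simp add: algebra_simps)
qed

context plane_prob
begin

text \<open>
  The threshold \<open>Y t\<close> for low frequencies is a multiple of \<open>c powr (t / 2)\<close>.  It has to grow
  exponentially, so that the logarithmic decay turns into a power of \<open>t\<close>, and its square may not
  exceed a small multiple of \<open>m t\<close>, as uniqueness of the low frequencies requires.
\<close>
lemma decay_along_lacunary:
  assumes decay: "log_decay \<nu> A" "2 < A"
    and c: "1 < c" and m: "\<And>t. 0 < m t" and growth: "\<And>t. c ^ t \<le> real (m t)"
  obtains e Y :: "nat \<Rightarrow> real" where "\<And>t. 0 \<le> e t" "summable (\<lambda>t. real (t + 1) * e t)"
    and "\<And>t k. k \<noteq> 0 \<Longrightarrow> norm (fourier \<nu> (- (of_int k * real (m t)), of_int k)) \<le> e t"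
    and "\<And>t. 8 * (Y t)\<^sup>2 \<le> (1 - 1 / c) * real (m t)" "\<And>t. Y t \<le> real (m t) / 2"
    and "\<And>t M k l. \<not> low_frequency M (m t) (Y t) k l \<Longrightarrow>
      norm (fourier \<nu> (- (of_int k * real M + of_int l * real (m t)), of_int (k + l))) \<le> e t"
proof -
  define \<kappa> where "\<kappa> = sqrt ((1 - 1 / c) / 8)"
  define b where "b = sqrt c"
  have \<kappa>: "0 < \<kappa>" "\<kappa>\<^sup>2 = (1 - 1 / c) / 8" using c by (auto simp: \<kappa>_def)
  have b: "1 < b" "b\<^sup>2 = c" using c by (auto simp: b_def)
  have "0 < A" using decay(2) by simp
  obtain C where C: "0 \<le> C" and
    fourier_le: "\<And>t \<xi>. \<xi> \<in> \<int> \<times> \<int> \<Longrightarrow> \<kappa> * b ^ t \<le> max_norm \<xi> \<Longrightarrow>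
           norm (fourier \<nu> \<xi>) \<le> C * real (t + 1) powr (- A)"
    by (rule fourier_decay_geometric[OF decay(1) \<open>0 < A\<close> b(1) \<kappa>(1)]) (rule that)
  define e where "e t = C * real (t + 1) powr (- A)" for t
  define Y where "Y t = \<kappa> * b ^ t" for t
  have Y8: "8 * (Y t)\<^sup>2 \<le> (1 - 1 / c) * real (m t)" for t
  proof -
    have "8 * (Y t)\<^sup>2 = (1 - 1 / c) * (b\<^sup>2) ^ t"
      by (simp add: Y_def power_mult_distrib \<kappa>(2) flip: power_mult) (simp add: mult.commute)
    then show ?thesis using growth[of t] c unfolding b(2) by (simp add: mult_left_mono)
  qed
  have Y2: "Y t \<le> real (m t) / 2" for t
  proof (rule power2_le_imp_le)
    have m1: "1 \<le> real (m t)" using m[of t] by simp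
    have "8 * (Y t)\<^sup>2 \<le> 1 * real (m t)"
      using c by (intro order_trans[OF Y8] mult_right_mono) auto
    moreover have "1 * real (m t) \<le> real (m t) * real (m t)" using m1 by (intro mult_right_mono) auto
    moreover have "(real (m t) / 2)\<^sup>2 = real (m t) * real (m t) / 4" by (simp add: power2_eq_square)
    ultimately show "(Y t)\<^sup>2 \<le> (real (m t) / 2)\<^sup>2" using zero_le_power2[of "Y t"] by linarith
  qed simp
  show thesis
  proof (rule that[of e Y])
    show "0 \<le> e t" for t using C by (simp add: e_def)
    have "summable (\<lambda>t. C * real (Suc t) powr (1 - A))"
      using summable_real_powr_iff[of "1 - A"] decay(2) summable_Suc_iff[of "\<lambda>t. real t powr (1 - A)"]
      by (intro summable_mult) simp
    moreover have "real (t + 1) * e t = C * real (Suc t) powr (1 - A)" for t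
      by (simp add: e_def powr_diff powr_minus field_simps)
    ultimately show "summable (\<lambda>t. real (t + 1) * e t)" by (simp only:)
    show "8 * (Y t)\<^sup>2 \<le> (1 - 1 / c) * real (m t)" "Y t \<le> real (m t) / 2" for t
      by (rule Y8, rule Y2)
    show "norm (fourier \<nu> (- (of_int k * real (m t)), of_int k)) \<le> e t" if "k \<noteq> 0" for t k
      unfolding e_def
    proof (rule fourier_le)
      show "(- (of_int k * real (m t)), of_int k) \<in> \<int> \<times> \<int>" by auto
      have "Y t \<le> 1 * real (m t)" using Y2[of t] m[of t] by simp
      also have "\<dots> \<le> \<bar>real_of_int k\<bar> * real (m t)" using that by (intro mult_right_mono) auto
      finally show "\<kappa> * b ^ t \<le> max_norm (- (of_int k * real (m t)), of_int k)"
        by (simp add: max_norm_def Y_def abs_mult le_max_iff_disj)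
    qed
    show "norm (fourier \<nu> (- (of_int k * real M + of_int l * real (m t)), of_int (k + l))) \<le> e t"
      if "\<not> low_frequency M (m t) (Y t) k l" for t M k l
      unfolding e_def
    proof (rule fourier_le)
      show "(- (of_int k * real M + of_int l * real (m t)), of_int (k + l)) \<in> \<int> \<times> \<int>" 
        by (intro SigmaI Ints_minus Ints_add Ints_mult Ints_of_int Ints_of_nat)
    qed (use that in \<open>simp add: low_frequency_def Y_def\<close>)
  qed
qed

lemma majorant_expectation_le:
  assumes "\<And>k. k \<noteq> 0 \<Longrightarrow> norm (fourier \<nu> (- (of_int k * real N), of_int k)) \<le> e" "0 \<le> e"
    and \<epsilon>: "0 \<le> \<epsilon>" "\<epsilon> \<le> 1"
  shows "(LINT p|\<nu>. majorant \<epsilon> (phase N p)) \<le> \<epsilon> + 2 * e"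
proof (cases "\<epsilon> = 0")
  case False
  then have "positive_fourier_series (majorant \<epsilon>) (majorant_coeff \<epsilon>)"
    using \<epsilon> by (intro positive_fourier_series_majorant) auto
  from first_moment[OF this assms(1,2)] show ?thesis by (simp add: majorant_coeff_def)
qed (use assms in \<open>simp add: majorant_def\<close>)

lemma dist_int_measurable [measurable]: "dist_int \<in> borel_measurable borel"
  unfolding dist_int_def dist_real_def round_def by measurable

lemma strip_measurable: "{p. dist_int (phase N p) \<le> r} \<in> sets \<nu>"
proof -
  have "{p \<in> space borel. dist_int (phase N p) \<le> r} \<in> sets borel" by measurable
  then show ?thesis by (simp add: sets_nu)
qed

text \<open>
  The radii are first enlarged to at least a constant times \<open>1 / t\<^sup>2\<close>: this costs nothing in
  summability and makes the width of the majorant positive.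
\<close>
lemma AE_finitely_many_hits:
  assumes decay: "log_decay \<nu> A" "2 < A"
    and c: "1 < c" and m: "\<And>t. 0 < m t" and growth: "\<And>t. c ^ t \<le> real (m t)"
    and \<phi>: "\<And>t. 0 \<le> \<phi> t" "\<And>t. \<phi> t \<le> 1" and sum: "summable \<phi>"
  shows "AE p in \<nu>. finite {t. dist_int (phase (m t) p) \<le> \<phi> t}"
proof -
  obtain e Y where e: "\<And>t. 0 \<le> e t" "summable (\<lambda>t. real (t + 1) * e t)"
    and e1: "\<And>t k. k \<noteq> 0 \<Longrightarrow> norm (fourier \<nu> (- (of_int k * real (m t)), of_int k)) \<le> e t"
    by (rule decay_along_lacunary[OF decay c m growth]) (rule that)
  note sum_e = summable_if_index_times_summable[OF e]
  define \<epsilon> where "\<epsilon> t = max (\<phi> t) (1 / real (Suc t) ^ 2) / 2" for t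
  have \<epsilon>: "0 < \<epsilon> t" "\<epsilon> t \<le> 1" "\<phi> t \<le> 2 * \<epsilon> t" for t
  proof -
    define x where "x = 1 / real (Suc t) ^ 2"
    have "x \<le> 1 / 1" unfolding x_def by (intro divide_left_mono one_le_power) auto
    moreover have "0 < x" by (simp add: x_def)
    moreover have "\<epsilon> t = max (\<phi> t) x / 2" by (simp add: \<epsilon>_def x_def)
    ultimately show "0 < \<epsilon> t" "\<epsilon> t \<le> 1" "\<phi> t \<le> 2 * \<epsilon> t"
      using \<phi>[of t] by auto
  qed
  have prob_le: "prob {p. dist_int (phase (m t) p) \<le> \<phi> t} \<le> 161 * (\<epsilon> t + 2 * e t)" for t
  proof -
    note series = positive_fourier_series_majorant[OF \<epsilon>(1,2)]
    note [measurable] = positive_fourier_series_measurable[OF series]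
    have int: "integrable \<nu> (\<lambda>p. majorant (\<epsilon> t) (phase (m t) p))"
      using positive_fourier_series_abs_le[OF series] by (intro bounded_integrable[where D = 2]) auto
    have "prob {p. dist_int (phase (m t) p) \<le> \<phi> t} = (LINT p|\<nu>. indicator {p. dist_int (phase (m t) p) \<le> \<phi> t} p)"
      using sets.Int_space_eq2[OF strip_measurable] by simp
    also have "\<dots> \<le> (LINT p|\<nu>. 161 * majorant (\<epsilon> t) (phase (m t) p))"
    proof (rule integral_mono)
      show "integrable \<nu> (\<lambda>p. indicat_real {p. dist_int (phase (m t) p) \<le> \<phi> t} p)"
        by (intro integrable_real_indicator strip_measurable) (simp add: emeasure_eq_measure)
      show "integrable \<nu> (\<lambda>p. 161 * majorant (\<epsilon> t) (phase (m t) p))"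
        by (intro integrable_mult_right int)
      show "indicator {p. dist_int (phase (m t) p) \<le> \<phi> t} p \<le> 161 * majorant (\<epsilon> t) (phase (m t) p)" for p
        using majorant_ge_on_strip[OF \<epsilon>(1,2)[of t], of "phase (m t) p"] \<epsilon>(3)[of t] \<epsilon>(1,2)[of t]
          poisson_kernel_nonneg[of "1 - \<epsilon> t" "phase (m t) p"]
        by (auto simp: indicator_def majorant_def)
    qed
    also have "\<dots> = 161 * (LINT p|\<nu>. majorant (\<epsilon> t) (phase (m t) p))" by simp
    also have "\<dots> \<le> 161 * (\<epsilon> t + 2 * e t)"
      using \<epsilon>(1,2)[of t] e1 e(1) by (intro mult_left_mono majorant_expectation_le) auto
    finally show ?thesis .
  qed
  have "AE p in \<nu>. eventually (\<lambda>t. p \<in> space \<nu> - {p. dist_int (phase (m t) p) \<le> \<phi> t}) sequentially"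
  proof (rule borel_cantelli_AE1)
    have "summable (\<lambda>t. \<phi> t + 1 / real (Suc t) ^ 2)"
      using sum inverse_squares_sums by (intro summable_add) (auto simp: sums_iff)
    then have "summable \<epsilon>"
    proof (rule summable_comparison_test'[of _ 0])
      show "norm (\<epsilon> t) \<le> \<phi> t + 1 / real (Suc t) ^ 2" for t
        using \<phi>[of t] \<epsilon>(1)[of t] by (simp add: \<epsilon>_def max_def)
    qed
    then have "summable (\<lambda>t. 161 * (\<epsilon> t + 2 * e t))"
      by (intro summable_mult summable_add sum_e)
    then show "summable (\<lambda>t. prob {p. dist_int (phase (m t) p) \<le> \<phi> t})"
      by (rule summable_comparison_test'[of _ 0]) (use prob_le in simp)
  qed (simp_all add: strip_measurable emeasure_eq_measure)
  then show ?thesis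
  proof eventually_elim
    fix p assume "eventually (\<lambda>t. p \<in> space \<nu> - {p. dist_int (phase (m t) p) \<le> \<phi> t}) sequentially"
    then obtain T where "\<And>t. T \<le> t \<Longrightarrow> \<not> dist_int (phase (m t) p) \<le> \<phi> t"
      unfolding eventually_sequentially by auto
    then have "{t. dist_int (phase (m t) p) \<le> \<phi> t} \<subseteq> {..<T}" by (auto simp: not_le[symmetric])
    then show "finite {t. dist_int (phase (m t) p) \<le> \<phi> t}" by (rule finite_subset) simp
  qed
qed

text \<open>
  All error terms are attributed to the larger index \<open>t\<close>.  Summed over \<open>s < t\<close> they are
  \<open>O(\<epsilon> t + t * e t)\<close>: the sequence \<open>e\<close> is summable, and so are the powers of \<open>1 / c\<close> that bound
  the ratios \<open>m s / m t\<close>.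
\<close>
lemma AE_infinitely_many_hits:
  assumes decay: "log_decay \<nu> A" "2 < A"
    and c: "1 < c" and m: "\<And>t. 0 < m t" and growth: "\<And>s t. c ^ t * real (m s) \<le> real (m (s + t))"
    and \<phi>: "\<And>t. 0 \<le> \<phi> t" "\<And>t. \<phi> t \<le> 1" and diverge: "\<not> summable \<phi>"
  shows "AE p in \<nu>. infinite {t. dist_int (phase (m t) p) \<le> \<phi> t}"
proof -
  have m1: "1 \<le> real (m t)" for t using m[of t] by simp
  have growth0: "c ^ t \<le> real (m t)" for t
  proof -
    have "c ^ t * 1 \<le> c ^ t * real (m 0)" using c m1[of 0] by (intro mult_left_mono) auto
    then show ?thesis using growth[of t 0] by simp
  qed
  obtain e Y where e: "\<And>t. 0 \<le> e t" "summable (\<lambda>t. real (t + 1) * e t)"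
    and e1: "\<And>t k. k \<noteq> 0 \<Longrightarrow> norm (fourier \<nu> (- (of_int k * real (m t)), of_int k)) \<le> e t"
    and Y: "\<And>t. 8 * (Y t)\<^sup>2 \<le> (1 - 1 / c) * real (m t)" "\<And>t. Y t \<le> real (m t) / 2"
    and e2: "\<And>t M k l. \<not> low_frequency M (m t) (Y t) k l \<Longrightarrow>
      norm (fourier \<nu> (- (of_int k * real M + of_int l * real (m t)), of_int (k + l))) \<le> e t"
    by (rule decay_along_lacunary[OF decay c m growth0]) (rule that)
  note sum_e = summable_if_index_times_summable[OF e]
  define \<epsilon> where "\<epsilon> t = \<phi> t / 2" for t
  have \<epsilon>: "0 \<le> \<epsilon> t" "\<epsilon> t \<le> 1 / 2" "\<epsilon> t \<le> 1" for t using \<phi>[of t] by (auto simp: \<epsilon>_def)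
  define h where "h t p = minorant (\<epsilon> t) (phase (m t) p)" for t p
  define g where "g t p = h t p - \<epsilon> t / 8" for t p
  note series = positive_fourier_series_minorant[OF \<epsilon>(1,3)]
  note [measurable] = positive_fourier_series_measurable[OF series]
  have h_borel [measurable]: "h t \<in> borel_measurable borel" for t unfolding h_def by measurable
  have h_meas [measurable]: "h t \<in> borel_measurable \<nu>" for t by (rule measurable_nu) measurable
  have h_bound: "\<bar>h t p\<bar> \<le> 2" for t p
    unfolding h_def by (rule positive_fourier_series_abs_le[OF series])
  have h_int: "integrable \<nu> (h t)" for t using h_bound by (intro integrable_const_bound[where B = 2]) auto
  have "\<bar>h s p * h t p\<bar> \<le> 2 * 2" for s t p
    unfolding abs_mult by (intro mult_mono h_bound) auto
  then have hh_int: "integrable \<nu> (\<lambda>p. h s p * h t p)" for s t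
    by (intro integrable_const_bound[where B = "2 * 2"] AE_I2) simp_all
  have mean: "\<bar>(LINT p|\<nu>. h t p) - \<epsilon> t / 8\<bar> \<le> 2 * e t" for t
    using first_moment[OF series[of t] e1 e(1)] by (simp add: h_def minorant_coeff_def)
  have corr: "\<bar>(LINT p|\<nu>. h s p * h t p) - (\<epsilon> s / 8) * (\<epsilon> t / 8)\<bar>
      \<le> 4 * e t + \<epsilon> t * e s + \<epsilon> t * (1 / c) ^ (t - s)" if "s < t" for s t
  proof -
    have "c ^ (t - s) * real (m s) \<le> real (m t)" using growth[of "t - s" s] that by simp
    then have ratio: "real (m s) / real (m t) \<le> (1 / c) ^ (t - s)"
      using m1[of t] c by (simp add: power_one_over field_simps)
    have "c ^ 1 \<le> c ^ (t - s)" using c that by (intro power_increasing) auto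
    then have "c * real (m s) \<le> real (m t)"
      using growth[of "t - s" s] that mult_right_mono[of c "c ^ (t - s)" "real (m s)"] by simp
    then have "\<bar>(LINT p|\<nu>. h s p * h t p) - (\<epsilon> s / 8) * (\<epsilon> t / 8)\<bar>
      \<le> 4 * e t + \<epsilon> t * e s + \<epsilon> t * (real (m s) / real (m t))"
      unfolding h_def by (intro minorant_correlation[OF c _ m Y \<epsilon>(1,3) \<epsilon>(1,3) e1 e2 e(1) e(1)])
    also have "\<dots> \<le> 4 * e t + \<epsilon> t * e s + \<epsilon> t * (1 / c) ^ (t - s)"
      using ratio \<epsilon>(1)[of t] by (intro add_left_mono mult_left_mono)
    finally show ?thesis .
  qed
  have cov: "\<bar>LINT p|\<nu>. g s p * g t p\<bar> \<le> 5 * e t + 2 * (\<epsilon> t * e s) + \<epsilon> t * (1 / c) ^ (t - s)" if "s < t" for s t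
  proof -
    have "(LINT p|\<nu>. g s p * g t p) = (LINT p|\<nu>. h s p * h t p - \<epsilon> s / 8 * h t p - \<epsilon> t / 8 * h s p + (\<epsilon> s / 8) * (\<epsilon> t / 8))"
      by (simp add: g_def algebra_simps)
    also have "\<dots> = (LINT p|\<nu>. h s p * h t p) - \<epsilon> s / 8 * (LINT p|\<nu>. h t p) - \<epsilon> t / 8 * (LINT p|\<nu>. h s p)
        + (\<epsilon> s / 8) * (\<epsilon> t / 8)"
      using h_int hh_int by (simp add: prob_space)
    also have "\<dots> = ((LINT p|\<nu>. h s p * h t p) - (\<epsilon> s / 8) * (\<epsilon> t / 8))
        - \<epsilon> s / 8 * ((LINT p|\<nu>. h t p) - \<epsilon> t / 8) - \<epsilon> t / 8 * ((LINT p|\<nu>. h s p) - \<epsilon> s / 8)"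
      by (simp add: algebra_simps)
    also have "\<bar>\<dots>\<bar> \<le> (4 * e t + \<epsilon> t * e s + \<epsilon> t * (1 / c) ^ (t - s)) + e t + \<epsilon> t * e s"
    proof -
      have "\<bar>\<epsilon> s / 8 * ((LINT p|\<nu>. h t p) - \<epsilon> t / 8)\<bar> \<le> 1 / 8 * (2 * e t)"
        unfolding abs_mult using \<epsilon>[of s] mean[of t] by (intro mult_mono) auto
      moreover have "\<bar>\<epsilon> t / 8 * ((LINT p|\<nu>. h s p) - \<epsilon> s / 8)\<bar> \<le> \<epsilon> t / 8 * (2 * e s)"
        unfolding abs_mult using \<epsilon>[of t] mean[of s] by (intro mult_mono) auto
      moreover have "0 \<le> \<epsilon> t * e s" "0 \<le> e t" using \<epsilon>(1)[of t] e(1) by auto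
      ultimately show ?thesis using corr[OF that] by linarith
    qed
    finally show ?thesis by simp
  qed
  \<comment> \<open>The minorant is bounded by 2, so its square is dominated by the majorant, whose mean is of
    order \<open>\<epsilon> t\<close>; the square of the mean of \<open>h t\<close> is smaller still.\<close>
  have diag: "(LINT p|\<nu>. (g t p)\<^sup>2) \<le> 9 * \<epsilon> t + 16 * e t" for t
  proof -
    have maj_int: "integrable \<nu> (\<lambda>p. majorant (\<epsilon> t) (phase (m t) p))"
    proof (cases "\<epsilon> t = 0")
      case False
      then have ser: "positive_fourier_series (majorant (\<epsilon> t)) (majorant_coeff (\<epsilon> t))"
        using \<epsilon>[of t] by (intro positive_fourier_series_majorant) auto
      note [measurable] = positive_fourier_series_measurable[OF ser]
      show ?thesis
        using positive_fourier_series_abs_le[OF ser] by (intro bounded_integrable[where D = 2]) auto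
    qed (simp add: majorant_def)
    have "(LINT p|\<nu>. (g t p)\<^sup>2) \<le> (LINT p|\<nu>. 8 * majorant (\<epsilon> t) (phase (m t) p) + \<epsilon> t)"
    proof (rule integral_mono)
      have "(\<lambda>p. (g t p)\<^sup>2) = (\<lambda>p. h t p * h t p - \<epsilon> t / 4 * h t p + (\<epsilon> t / 8)\<^sup>2)"
        by (simp add: g_def power2_eq_square algebra_simps)
      then show "integrable \<nu> (\<lambda>p. (g t p)\<^sup>2)" using h_int hh_int by simp
      show "integrable \<nu> (\<lambda>p. 8 * majorant (\<epsilon> t) (phase (m t) p) + \<epsilon> t)" using maj_int by simp
      fix p
      have "(g t p)\<^sup>2 \<le> 2 * (h t p)\<^sup>2 + 2 * (\<epsilon> t / 8)\<^sup>2"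
        using zero_le_power2[of "h t p + \<epsilon> t / 8"] by (simp add: g_def power2_eq_square algebra_simps)
      also have "(\<epsilon> t / 8)\<^sup>2 \<le> \<epsilon> t / 2"
        using \<epsilon>[of t] mult_left_mono[of "\<epsilon> t" 1 "\<epsilon> t"] by (simp add: power2_eq_square)
      also have "(h t p)\<^sup>2 \<le> 2 * \<bar>h t p\<bar>"
        using mult_right_mono[OF h_bound[of t p], of "\<bar>h t p\<bar>"] by (simp add: power2_eq_square)
      also have "\<bar>h t p\<bar> \<le> 2 * majorant (\<epsilon> t) (phase (m t) p)"
        unfolding h_def by (rule minorant_abs_le[OF \<epsilon>(1,2)])
      finally show "(g t p)\<^sup>2 \<le> 8 * majorant (\<epsilon> t) (phase (m t) p) + \<epsilon> t" by simp
    qed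
    also have "\<dots> = 8 * (LINT p|\<nu>. majorant (\<epsilon> t) (phase (m t) p)) + \<epsilon> t"
      using maj_int by (simp add: prob_space)
    also have "\<dots> \<le> 8 * (\<epsilon> t + 2 * e t) + \<epsilon> t"
      using \<epsilon>[of t] e1 e(1) by (intro add_right_mono mult_left_mono majorant_expectation_le) auto
    finally show ?thesis by simp
  qed
  define Q where "Q = 1 / (1 - 1 / c)"
  have Q: "(\<Sum>s<t. (1 / c) ^ (t - s)) \<le> Q" for t
  proof -
    have "(\<Sum>s<t. (1 / c) ^ (t - s)) = (\<Sum>j<t. (1 / c) ^ Suc j)"
      by (rule sum.reindex_bij_witness[of _ "\<lambda>j. t - Suc j" "\<lambda>s. t - Suc s"]) (auto simp: Suc_diff_Suc)
    also have "\<dots> \<le> (\<Sum>j<t. (1 / c) ^ j)" using c by (intro sum_mono power_decreasing) auto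
    also have "\<dots> \<le> (\<Sum>j. (1 / c) ^ j)" using c by (intro sum_le_suminf summable_geometric) auto
    also have "\<dots> = Q" using c by (simp add: suminf_geometric Q_def)
    finally show ?thesis .
  qed
  define C1 where "C1 = 9 + 4 * suminf e + 2 * Q"
  have v: "(LINT p|\<nu>. (g t p)\<^sup>2) + 2 * (\<Sum>s<t. \<bar>LINT p|\<nu>. g s p * g t p\<bar>)
      \<le> C1 * \<epsilon> t + 26 * (real (t + 1) * e t)" for t
  proof -
    have "(\<Sum>s<t. \<bar>LINT p|\<nu>. g s p * g t p\<bar>) \<le>
        (\<Sum>s<t. 5 * e t + 2 * (\<epsilon> t * e s) + \<epsilon> t * (1 / c) ^ (t - s))"
      by (intro sum_mono cov) simp
    also have "\<dots> = 5 * (real t * e t) + 2 * (\<epsilon> t * (\<Sum>s<t. e s)) + \<epsilon> t * (\<Sum>s<t. (1 / c) ^ (t - s))"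
      by (simp add: sum.distrib sum_distrib_left)
    also have "\<dots> \<le> 5 * (real t * e t) + 2 * (\<epsilon> t * suminf e) + \<epsilon> t * Q"
      using \<epsilon>(1)[of t] e(1) sum_e Q by (intro add_mono mult_left_mono sum_le_suminf) auto
    finally have "(\<Sum>s<t. \<bar>LINT p|\<nu>. g s p * g t p\<bar>)
        \<le> 5 * (real t * e t) + 2 * (\<epsilon> t * suminf e) + \<epsilon> t * Q" .
    moreover have "0 \<le> real t * e t" using e(1)[of t] by simp
    moreover have "C1 * \<epsilon> t + 26 * (real (t + 1) * e t) =
        9 * \<epsilon> t + 4 * (\<epsilon> t * suminf e) + 2 * (\<epsilon> t * Q) + 26 * (real t * e t) + 26 * e t"
      by (simp add: C1_def algebra_simps)
    ultimately show ?thesis using diag[of t] e(1)[of t] by linarith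
  qed
  have var: "(LINT p|\<nu>. (\<Sum>t<T. h t p - \<epsilon> t / 8)\<^sup>2) \<le> (8 * C1 + 26 * (\<Sum>t. real (t + 1) * e t)) * ((\<Sum>t<T. \<epsilon> t / 8) + 1)" for T
  proof -
    have "(LINT p|\<nu>. (\<Sum>t<T. g t p)\<^sup>2) \<le> (\<Sum>t<T. C1 * \<epsilon> t + 26 * (real (t + 1) * e t))"
    proof (rule expectation_square_sum_le[OF _ _ v])
      show "g t \<in> borel_measurable \<nu>" for t unfolding g_def by measurable
      show "\<bar>g t p\<bar> \<le> 3" for t p using h_bound[of t p] \<epsilon>[of t] by (auto simp: g_def abs_le_iff)
    qed
    also have "\<dots> = 8 * C1 * (\<Sum>t<T. \<epsilon> t / 8) + 26 * (\<Sum>t<T. real (t + 1) * e t)"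
      by (simp add: sum.distrib sum_distrib_left)
    also have "(\<Sum>t<T. real (t + 1) * e t) \<le> (\<Sum>t. real (t + 1) * e t)"
      using e by (intro sum_le_suminf) auto
    also have "8 * C1 * (\<Sum>t<T. \<epsilon> t / 8) + 26 * (\<Sum>t. real (t + 1) * e t)
        \<le> (8 * C1 + 26 * (\<Sum>t. real (t + 1) * e t)) * ((\<Sum>t<T. \<epsilon> t / 8) + 1)"
    proof -
      have "0 \<le> (\<Sum>t. real (t + 1) * e t)" "0 \<le> suminf e" using e sum_e by (auto intro!: suminf_nonneg)
      moreover have "0 \<le> C1" using \<open>0 \<le> suminf e\<close> c by (simp add: C1_def Q_def)
      moreover have "0 \<le> (\<Sum>t<T. \<epsilon> t / 8)" using \<epsilon> by (intro sum_nonneg) auto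
      ultimately show ?thesis by (simp add: distrib_left distrib_right)
    qed
    finally show ?thesis by (simp add: g_def)
  qed
  have div: "filterlim (\<lambda>T. \<Sum>t<T. \<epsilon> t / 8) at_top sequentially"
    unfolding filterlim_at_top
  proof
    fix Z
    have "\<exists>T. Z < (\<Sum>t<T. \<epsilon> t / 8)"
    proof (rule ccontr)
      assume "\<not> (\<exists>T. Z < (\<Sum>t<T. \<epsilon> t / 8))"
      then have "summable (\<lambda>t. \<epsilon> t / 8)" using \<epsilon> by (intro summableI_nonneg_bounded[of _ Z]) (auto simp: not_less)
      then have "summable (\<lambda>t. 16 * (\<epsilon> t / 8))" by (rule summable_mult)
      then show False using diverge by (simp add: \<epsilon>_def)
    qed
    then obtain T0 where T0: "Z < (\<Sum>t<T0. \<epsilon> t / 8)" ..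
    have "(\<Sum>t<T0. \<epsilon> t / 8) \<le> (\<Sum>t<T. \<epsilon> t / 8)" if "T0 \<le> T" for T
      using that \<epsilon> by (intro sum_mono2) auto
    then show "eventually (\<lambda>T. Z \<le> (\<Sum>t<T. \<epsilon> t / 8)) sequentially"
      using T0 unfolding eventually_sequentially by (intro exI[of _ T0]) force
  qed
  have "AE p in \<nu>. infinite {t. p \<in> {p. dist_int (phase (m t) p) \<le> \<phi> t}}"
  proof (rule AE_infinitely_often_if_variance_small[OF strip_measurable h_meas h_bound _ div var])
    show "h t p \<le> indicator {p. dist_int (phase (m t) p) \<le> \<phi> t} p" for t p
      using minorant_le_indicator[OF \<epsilon>(1,2), of t "phase (m t) p"]
      by (auto simp: h_def \<epsilon>_def indicator_def)
  qed
  then show ?thesis by simp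
qed

end

lemma infinite_hits_shift:
  "infinite {t :: nat. t \<ge> 1 \<and> P t} \<longleftrightarrow> infinite {t. P (t + 1)}"
proof -
  have "{t. t \<ge> 1 \<and> P t} = Suc ` {t. P (t + 1)}"
    by (auto simp: image_iff) (metis Suc_le_D)
  then show ?thesis by (simp add: finite_image_iff)
qed

theorem theorem1p4:
  fixes n :: "nat \<Rightarrow> nat"
  assumes "\<And>t. t \<ge> 1 \<Longrightarrow> n t > 0"
    and "lacunary n"
  shows "\<exists>A0\<ge>2. \<forall>A>A0. \<forall>(\<nu> :: (real \<times> real) measure) (\<psi> :: nat \<Rightarrow> real).
    prob_space \<nu> \<longrightarrow> sets \<nu> = sets borel \<longrightarrow> emeasure \<nu> ({0..1} \<times> {0..1}) = 1 \<longrightarrow>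
    log_decay \<nu> A \<longrightarrow> (\<forall>t\<ge>1. \<psi> t \<in> {0..1}) \<longrightarrow>
    emeasure \<nu> (W_set n \<psi>) = (if summable (\<lambda>t. \<psi> (t + 1)) then 0 else 1)"
proof (intro exI[of _ 2] conjI allI impI order_refl)
  fix A :: real and \<nu> :: "(real \<times> real) measure" and \<psi> :: "nat \<Rightarrow> real"
  assume A: "2 < A" and prob: "prob_space \<nu>" and sets: "sets \<nu> = sets borel"
    and square: "emeasure \<nu> ({0..1} \<times> {0..1}) = 1" and decay: "log_decay \<nu> A"
    and \<psi>: "\<forall>t\<ge>1. \<psi> t \<in> {0..1}"
  interpret plane_prob \<nu> using prob sets by (simp add: plane_prob_def plane_prob_axioms_def)
  obtain c where c: "1 < c" and lac: "\<And>t. t \<ge> 1 \<Longrightarrow> c * real (n t) \<le> real (n (t + 1))"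
    using assms(2) by (auto simp: lacunary_def)
  define m where "m t = n (t + 1)" for t
  define \<phi> where "\<phi> t = \<psi> (t + 1)" for t
  have m: "0 < m t" for t using assms(1) by (simp add: m_def)
  have growth: "c ^ t * real (m s) \<le> real (m (s + t))" for s t
  proof (induction t)
    case (Suc t)
    have "c ^ Suc t * real (m s) \<le> c * real (m (s + t))"
      using mult_left_mono[OF Suc, of c] c by (simp add: mult_ac)
    also have "\<dots> \<le> real (m (s + Suc t))" using lac[of "s + t + 1"] by (simp add: m_def)
    finally show ?case .
  qed simp
  have growth0: "c ^ t \<le> real (m t)" for t
  proof -
    have "c ^ t * 1 \<le> c ^ t * real (m 0)" using c m[of 0] by (intro mult_left_mono) auto
    also have "\<dots> \<le> real (m t)" using growth[of t 0] by simp
    finally show ?thesis by simp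
  qed
  have \<phi>: "0 \<le> \<phi> t" "\<phi> t \<le> 1" for t using \<psi> by (auto simp: \<phi>_def)
  have W: "p \<in> W_set n \<psi> \<longleftrightarrow>
      p \<in> {0..1} \<times> {0..1} \<and> infinite {t. dist_int (phase (m t) p) \<le> \<phi> t}" for p
    using infinite_hits_shift[of "\<lambda>t. dist_int (real (n t) * fst p - snd p) \<le> \<psi> t"]
    by (cases p) (auto simp: W_set_def phase_def m_def \<phi>_def)
  have W_sets: "W_set n \<psi> \<in> events" by (simp add: sets W_set_borel)
  show "emeasure \<nu> (W_set n \<psi>) = (if summable (\<lambda>t. \<psi> (t + 1)) then 0 else 1)"
  proof (cases "summable \<phi>")
    case True
    have "AE p in \<nu>. p \<notin> W_set n \<psi>"
      using AE_finitely_many_hits[OF decay A c m growth0 \<phi> True] by eventually_elim (simp add: W)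
    then have "emeasure \<nu> {p \<in> space \<nu>. p \<in> W_set n \<psi>} = 0" by (rule emeasure_eq_0_AE)
    moreover have "{p \<in> space \<nu>. p \<in> W_set n \<psi>} = W_set n \<psi>"
      using sets.sets_into_space[OF W_sets] by auto
    ultimately show ?thesis using True unfolding \<phi>_def by simp
  next
    case False
    have "{0..1} \<times> {0..1} \<in> events"
      unfolding sets by (intro borel_closed closed_Times) auto
    then have "AE p in \<nu>. p \<in> {0..1} \<times> {0..1}"
      using square by (simp add: emeasure_eq_measure prob_eq_1)
    with AE_infinitely_many_hits[OF decay A c m growth \<phi> False] have "AE p in \<nu>. p \<in> W_set n \<psi>"
      by eventually_elim (simp add: W)
    then have "emeasure \<nu> (W_set n \<psi>) = 1" by (rule emeasure_eq_1_AE[OF W_sets])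
    then show ?thesis using False unfolding \<phi>_def by simp
  qed
qed

end
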